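(* Let $d\ge1$ and $1\le e\le d$ be integers, let $I\subset\mathbb{Z}^e$ be a finite index set, and let $\Lambda: I-I:=\{i-j:\ i,j\in I\}\to[0,1]$ satisfy $\Lambda(k)=\Lambda(-k)$ and $\Lambda(0)=1$. Let $$D_I:=\left\{x=(x_i)_{i\in I},\ x_i=(x_i^1,\dots,x_i^d)\in[0,1]^d:\ x_i^k\neq x_j^k \text{ for all } k\in\{1,\dots,d\} \text{ whenever } i\neq j\right\}.$$ For $x\in([0,1]^d)^I$ let $(C_i(x))_{i\in I}$ be the Voronoi partition of $[0,1]^d$ ($C_i(x)$ consists of the $\omega$ with $\Vert x_i-\omega\Vert<\Vert x_k-\omega\Vert$ for all $k\ne i$, ties assigned by lexicographical order), and $\bar C_i(x)$ its closure. Let $P(d\omega)=f(\omega)\,d\omega$ with $f$ continuous on $[0,1]^d$, and let $$V(x)=\frac12\sum_{i,j\in I}\Lambda(i-j)\int_{C_i(x)}\Vert x_j-\omega\Vert^2\,P(d\omega).$$ Then $V$ is continuously differentiable on $D_I$, and for every $i\in I$, $$\frac{\partial V}{\partial x_i}(x)=\sum_{k\in I}\Lambda(i-k)\int_{C_k(x)}(x_i-\omega)\,P(d\omega) +\frac12\sum_{j\in I}\sum_{k\in I,k\neq i}\big(\Lambda(k-j)-\Lambda(i-j)\big)\int_{\bar C_k(x)\cap\bar C_i(x)}\Vert x_j-\omega\Vert^2\left(\frac12\,\vec n^{\,ki}_x+\frac{1}{\Vert x_k-x_i\Vert}\Big(\frac{x_i+x_k}{2}-\omega\Big)\right)f(\omega)\,\lambda^{ki}_x(d\omega),$$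 where $\frac{\partial V}{\partial x_i}(x)$ denotes the column vector $\big(\frac{\partial V}{\partial x_i^1}(x),\dots,\frac{\partial V}{\partial x_i^d}(x)\big)^T$.
   Context: $\Vert\cdot\Vert$ is the Euclidean norm. For $i\neq j$, $\vec n^{\,ij}_x:=\frac{x_j-x_i}{\Vert x_j-x_i\Vert}$ (so $\vec n^{\,ki}_x=\frac{x_i-x_k}{\Vert x_i-x_k\Vert}$). $M^{ij}_x$ denotes the mediator (perpendicular bisector) hyperplane of $x_i$ and $x_j$ in $\mathbb{R}^d$, i.e. $\{u:\langle u-\frac{x_i+x_j}{2},x_i-x_j\rangle=0\}$, and $\lambda^{ij}_x$ is the $(d-1)$-dimensional Lebesgue measure on $M^{ij}_x$; the integrals over $\bar C_k(x)\cap\bar C_i(x)$ (a subset of $M^{ki}_x$) are taken with respect to $\lambda^{ki}_x$. *)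

theory Defs
  imports "HOL-Analysis.Analysis"
begin

definition unit_cube :: "(real^'d) set" where
  "unit_cube = {w. \<forall>k. 0 \<le> w$k \<and> w$k \<le> 1}"

definition lex_less :: "(int, 'e::{finite,wellorder}) vec \<Rightarrow> (int, 'e) vec \<Rightarrow> bool" where
  "lex_less a b \<longleftrightarrow> (\<exists>m. a$m < b$m \<and> (\<forall>m'. m' < m \<longrightarrow> a$m' = b$m'))"

definition config_D :: "((real^'d)^'i) set" where
  "config_D = {x. (\<forall>i. x$i \<in> unit_cube) \<and> (\<forall>i j. i \<noteq> j \<longrightarrow> (\<forall>k. x$i$k \<noteq> x$j$k))}"

definition voronoi_cell ::
  "('i \<Rightarrow> (int, 'e::{finite,wellorder}) vec) \<Rightarrow> (real^'d)^'i \<Rightarrow> 'i \<Rightarrow> (real^'d) set" where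
  "voronoi_cell \<iota> x i = {w \<in> unit_cube. \<forall>k. k \<noteq> i \<longrightarrow>
      (norm (x$i - w) < norm (x$k - w) \<or>
       (norm (x$i - w) = norm (x$k - w) \<and> lex_less (\<iota> i) (\<iota> k)))}"

text \<open>(d-1)-dimensional Lebesgue measure on the hyperplane through p with unit normal n:
  push-forward, under orthogonal projection onto the hyperplane, of Lebesgue measure
  restricted to the prism (hyperplane) + [0,1] n of height 1.\<close>
definition hyperplane_measure :: "'a::euclidean_space \<Rightarrow> 'a \<Rightarrow> 'a measure" where
  "hyperplane_measure p n =
     distr (density lborel (indicator {p + u + t *\<^sub>R n | u t. u \<bullet> n = 0 \<and> t \<in> {0..1}}))
           lborel (\<lambda>v. v - ((v - p) \<bullet> n) *\<^sub>R n)"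

definition nvec :: "(real^'d)^'i \<Rightarrow> 'i \<Rightarrow> 'i \<Rightarrow> real^'d" where
  "nvec x i j = (1 / norm (x$j - x$i)) *\<^sub>R (x$j - x$i)"

definition mediator_measure :: "(real^'d)^'i \<Rightarrow> 'i \<Rightarrow> 'i \<Rightarrow> (real^'d) measure" where
  "mediator_measure x i j = hyperplane_measure ((1/2) *\<^sub>R (x$i + x$j)) (nvec x i j)"

definition quant_V ::
  "('i::finite \<Rightarrow> (int, 'e::{finite,wellorder}) vec) \<Rightarrow> ((int, 'e) vec \<Rightarrow> real) \<Rightarrow> (real^'d \<Rightarrow> real)
     \<Rightarrow> (real^'d)^'i \<Rightarrow> real" where
  "quant_V \<iota> \<Lambda> f x = (1/2) * (\<Sum>i\<in>UNIV. \<Sum>j\<in>UNIV. \<Lambda> (\<iota> i - \<iota> j) *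
      (LINT w:(voronoi_cell \<iota> x i)|lebesgue. (norm (x$j - w))^2 * f w))"

definition grad_V ::
  "('i::finite \<Rightarrow> (int, 'e::{finite,wellorder}) vec) \<Rightarrow> ((int, 'e) vec \<Rightarrow> real) \<Rightarrow> (real^'d \<Rightarrow> real)
     \<Rightarrow> (real^'d)^'i \<Rightarrow> 'i \<Rightarrow> real^'d" where
  "grad_V \<iota> \<Lambda> f x i =
     (\<Sum>k\<in>UNIV. \<Lambda> (\<iota> i - \<iota> k) *\<^sub>R (LINT w:(voronoi_cell \<iota> x k)|lebesgue. f w *\<^sub>R (x$i - w)))
     + (1/2) *\<^sub>R (\<Sum>j\<in>UNIV. \<Sum>k\<in>{k. k \<noteq> i}. (\<Lambda> (\<iota> k - \<iota> j) - \<Lambda> (\<iota> i - \<iota> j)) *\<^sub>R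
         (LINT w:(closure (voronoi_cell \<iota> x k) \<inter> closure (voronoi_cell \<iota> x i))|mediator_measure x k i.
            f w *\<^sub>R ((norm (x$j - w))^2 *\<^sub>R
              ((1/2) *\<^sub>R nvec x k i + (1 / norm (x$k - x$i)) *\<^sub>R ((1/2) *\<^sub>R (x$i + x$k) - w)))))"

end

theory Submission
  imports Defs
begin

text \<open>Fix a coordinate axis $e$. On the configurations considered no mediator contains the direction $e$,
  so the facets of a cell can be parametrised by projecting along $e$, and the hyperplane measure becomes,
  up to the factor $1/|\langle e,n\rangle|$, Lebesgue measure on a slab of height one orthogonal to $e$.
  By Fubini along $e$ the integral of a fixed continuous $g$ over a cell becomes the integral of a
  one-dimensional integral of $g$ over an interval whose endpoints are the intersections of a line with
  the mediators. For almost every line these endpoints are distinct and not on the boundary of the cube;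
  there the inner integral is differentiable by the fundamental theorem of calculus, and it is Lipschitz in
  the configuration, so dominated convergence differentiates the cell integral. The same parametrisation and
  dominated convergence give continuity of the facet integrals. For the moving integrand one expands
  $|y_j-\omega|^2 = |x_j-\omega|^2 + 2\langle x_j-\omega, y_j-x_j\rangle + |y_j-x_j|^2$.\<close>

section \<open>Oblique description of the hyperplane measure\<close>

text \<open>On a given line the one-dimensional derivative formula is valid only while the endpoints
  move less than their mutual distance. That distance can be arbitrarily small from line to line, so
  no neighbourhood of configurations serves all lines. Hence the dominating function comes from a
  separate Lipschitz estimate that lets endpoints cross. The slab replaces a (d-1)-dimensional
  parameter space: the lines through its points in direction $e$ cover each point of space with
  total weight one, so neither a basis of the hyperplane nor a splitting of \<open>real^'d\<close>
  is needed. Distinctness in all coordinates is used twice. It lets any axis serve as $e$, and it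
  puts the midpoint of two sites strictly inside the cube. Genericity is always obtained from one
  point at which an affine function is nonzero; this also covers dimension one, where a mediator is
  a point and its projection is constant. Sites may lie on the boundary of the cube, so
  \<open>config_D\<close> is not open and derivatives are taken within it.\<close>

lemma AE_affine_nonzero:
  fixes L :: "'a::euclidean_space \<Rightarrow> real"
  assumes L: "\<And>v. L v = A \<bullet> v + b" and p: "L p \<noteq> 0"
  shows "AE v in lborel. L v \<noteq> 0"
proof -
  \<comment> \<open>The linear part is allowed to vanish, as happens in dimension one; the zero set
    is then empty because the constant does not vanish.\<close>
  have "A \<noteq> 0 \<or> - b \<noteq> 0" using p by (auto simp: L)
  then have "negligible {v. A \<bullet> v = - b}" by (rule negligible_hyperplane)
  then have "{v. A \<bullet> v = - b} \<in> null_sets lebesgue" by (simp add: negligible_iff_null_sets)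
  moreover have "closed {v. A \<bullet> v = - b}" by (rule closed_hyperplane)
  then have "{v. A \<bullet> v = - b} \<in> sets lborel" by simp
  ultimately have "{v. A \<bullet> v = - b} \<in> null_sets lborel" by (simp add: null_sets_completion_iff)
  then show ?thesis
    by (rule AE_I') (auto simp: L)
qed

section \<open>Fubini along a unit vector, with a slab of height one as parameter space\<close>

definition slab :: "'a::euclidean_space \<Rightarrow> 'a set" where
  "slab e = {v. v \<bullet> e \<in> {0..1}}"

lemma slab_measurable [measurable]: "slab e \<in> sets borel"
proof -
  have "closed {v. v \<bullet> e \<in> {0..1}}"
    by (auto intro!: closed_Collect_conj closed_Collect_le continuous_intros)
  then show ?thesis unfolding slab_def by simp
qed

lemma nn_integral_lborel_translate:
  fixes h :: "'a::euclidean_space \<Rightarrow> ennreal"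
  assumes [measurable]: "h \<in> borel_measurable borel"
  shows "(\<integral>\<^sup>+v. h (v + c) \<partial>lborel) = (\<integral>\<^sup>+v. h v \<partial>lborel)"
proof -
  have "(\<integral>\<^sup>+v. h v \<partial>lborel) = (\<integral>\<^sup>+v. h v \<partial>distr lborel borel ((+) c))"
    by (simp only: lborel_distr_plus)
  also have "\<dots> = (\<integral>\<^sup>+v. h (c + v) \<partial>lborel)" by (rule nn_integral_distr) auto
  finally show ?thesis by (simp add: add.commute)
qed

text \<open>Swapping the integrals and translating \<open>v\<close> by
  \<open>- t *\<^sub>R e\<close> leaves, for each \<open>w\<close>, the length of the set of
  \<open>t\<close> with \<open>w - t *\<^sub>R e\<close> in the slab. As \<open>e\<close> is a unit
  vector and the slab has height one, this is an interval of length one.\<close>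

lemma nn_integral_oblique:
  fixes h :: "'a::euclidean_space \<Rightarrow> ennreal"
  assumes [measurable]: "h \<in> borel_measurable borel" and e: "e \<bullet> e = 1"
  shows "(\<integral>\<^sup>+v. indicator (slab e) v * (\<integral>\<^sup>+t. h (v + t *\<^sub>R e) \<partial>lborel) \<partial>lborel) = (\<integral>\<^sup>+w. h w \<partial>lborel)"
proof -
  have unit: "(\<integral>\<^sup>+t. indicator (slab e) (w + (- t) *\<^sub>R e) \<partial>lborel) = 1" for w
  proof -
    have "indicator (slab e) (w + (- t) *\<^sub>R e) = (indicator {w \<bullet> e - 1..w \<bullet> e} t :: ennreal)" for t
      by (auto simp: slab_def indicator_def inner_diff_left e)
    then show ?thesis by simp
  qed
  have "(\<integral>\<^sup>+v. indicator (slab e) v * (\<integral>\<^sup>+t. h (v + t *\<^sub>R e) \<partial>lborel) \<partial>lborel)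
      = (\<integral>\<^sup>+v. (\<integral>\<^sup>+t. indicator (slab e) v * h (v + t *\<^sub>R e) \<partial>lborel) \<partial>lborel)"
    by (simp add: nn_integral_cmult)
  also have "\<dots> = (\<integral>\<^sup>+t. (\<integral>\<^sup>+v. indicator (slab e) v * h (v + t *\<^sub>R e) \<partial>lborel) \<partial>lborel)"
    by (rule lborel_pair.Fubini') measurable
  also have "\<dots> = (\<integral>\<^sup>+t. (\<integral>\<^sup>+v. indicator (slab e) (v + (- t) *\<^sub>R e) * h v \<partial>lborel) \<partial>lborel)"
  proof (rule nn_integral_cong)
    fix t :: real
    have "(\<integral>\<^sup>+v. indicator (slab e) v * h (v + t *\<^sub>R e) \<partial>lborel)
        = (\<integral>\<^sup>+v. (\<lambda>v. indicator (slab e) (v + (- t) *\<^sub>R e) * h v) (v + t *\<^sub>R e) \<partial>lborel)"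
      by simp
    also have "\<dots> = (\<integral>\<^sup>+v. indicator (slab e) (v + (- t) *\<^sub>R e) * h v \<partial>lborel)"
      by (rule nn_integral_lborel_translate) measurable
    finally show "(\<integral>\<^sup>+v. indicator (slab e) v * h (v + t *\<^sub>R e) \<partial>lborel)
        = (\<integral>\<^sup>+v. indicator (slab e) (v + (- t) *\<^sub>R e) * h v \<partial>lborel)" .
  qed
  also have "\<dots> = (\<integral>\<^sup>+v. (\<integral>\<^sup>+t. indicator (slab e) (v + (- t) *\<^sub>R e) * h v \<partial>lborel) \<partial>lborel)"
    by (rule lborel_pair.Fubini') measurable
  also have "\<dots> = (\<integral>\<^sup>+v. h v \<partial>lborel)"
    by (subst nn_integral_multc) (auto simp only: unit mult_1, measurable)
  finally show ?thesis .
qed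

text \<open>As an identity of measures, the nonnegative case transfers at once to Bochner integrals
  and integrability of vector-valued functions, through the rules for \<open>distr\<close> and
  \<open>density\<close>.\<close>

lemma lborel_eq_distr_oblique:
  fixes e :: "'a::euclidean_space"
  assumes e: "e \<bullet> e = 1"
  shows "distr (density (lborel \<Otimes>\<^sub>M lborel) (\<lambda>z. ennreal (indicator (slab e) (fst z)))) lborel
           (\<lambda>z. fst z + snd z *\<^sub>R e) = lborel" (is "distr ?D lborel ?T = lborel")
proof (rule measure_eqI)
  fix B assume "B \<in> sets (distr ?D lborel ?T)"
  then have B [measurable]: "B \<in> sets borel" by simp
  have T [measurable]: "?T \<in> measurable ?D lborel" by measurable
  have "emeasure (distr ?D lborel ?T) B = (\<integral>\<^sup>+z. indicator B z \<partial>distr ?D lborel ?T)" by simp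
  also have "\<dots> = (\<integral>\<^sup>+z. indicator B (?T z) \<partial>?D)"
    by (rule nn_integral_distr) auto
  also have "\<dots> = (\<integral>\<^sup>+z. ennreal (indicator (slab e) (fst z)) * indicator B (?T z) \<partial>(lborel \<Otimes>\<^sub>M lborel))"
    by (rule nn_integral_density) measurable
  also have "\<dots> = (\<integral>\<^sup>+v. (\<integral>\<^sup>+t. indicator (slab e) v * indicator B (v + t *\<^sub>R e) \<partial>lborel) \<partial>lborel)"
    by (subst lborel.nn_integral_fst[symmetric]) (measurable, simp add: ennreal_indicator)
  also have "\<dots> = (\<integral>\<^sup>+v. indicator (slab e) v * (\<integral>\<^sup>+t. indicator B (v + t *\<^sub>R e) \<partial>lborel) \<partial>lborel)"
    by (simp add: nn_integral_cmult)
  also have "\<dots> = (\<integral>\<^sup>+v. indicator B v \<partial>lborel)"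
    by (rule nn_integral_oblique[OF _ e]) measurable
  finally show "emeasure (distr ?D lborel ?T) B = emeasure lborel B" by simp
qed simp

lemma
  fixes h :: "'a::euclidean_space \<Rightarrow> 'b::{banach, second_countable_topology}"
  assumes h: "integrable lborel h" and e: "e \<bullet> e = 1"
  shows integral_oblique: "(\<integral>w. h w \<partial>lborel) = (\<integral>v. (\<integral>t. indicator (slab e) v *\<^sub>R h (v + t *\<^sub>R e) \<partial>lborel) \<partial>lborel)"
    and integrable_oblique: "integrable lborel (\<lambda>v. (\<integral>t. indicator (slab e) v *\<^sub>R h (v + t *\<^sub>R e) \<partial>lborel))"
proof -
  let ?D = "density (lborel \<Otimes>\<^sub>M lborel) (\<lambda>z. ennreal (indicator (slab e) (fst z)))"
  let ?T = "\<lambda>z. fst z + snd z *\<^sub>R e"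
  have [measurable]: "h \<in> borel_measurable borel" using borel_measurable_integrable[OF h] by simp
  have T [measurable]: "?T \<in> measurable ?D lborel" by measurable
  have "integrable (distr ?D lborel ?T) h" using h lborel_eq_distr_oblique[OF e] by simp
  then have "integrable ?D (\<lambda>z. h (?T z))" by (rule integrable_distr[OF T])
  then have i: "integrable (lborel \<Otimes>\<^sub>M lborel) (\<lambda>(v,t). indicator (slab e) v *\<^sub>R h (v + t *\<^sub>R e))"
    by (subst (asm) integrable_density) (measurable, auto simp: case_prod_beta')
  have "(\<integral>w. h w \<partial>lborel) = (\<integral>w. h w \<partial>distr ?D lborel ?T)"
    by (simp only: lborel_eq_distr_oblique[OF e])
  also have "\<dots> = (\<integral>z. h (?T z) \<partial>?D)" by (rule integral_distr) auto
  also have "\<dots> = (\<integral>z. indicator (slab e) (fst z) *\<^sub>R h (?T z) \<partial>(lborel \<Otimes>\<^sub>M lborel))"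
    by (rule integral_density) auto
  also have "\<dots> = (\<integral>z. (case z of (v,t) \<Rightarrow> indicator (slab e) v *\<^sub>R h (v + t *\<^sub>R e)) \<partial>(lborel \<Otimes>\<^sub>M lborel))"
    by (simp add: case_prod_beta')
  also have "\<dots> = (\<integral>v. (\<integral>t. indicator (slab e) v *\<^sub>R h (v + t *\<^sub>R e) \<partial>lborel) \<partial>lborel)"
    using lborel_pair.integral_fst'[OF i] by simp
  finally show "(\<integral>w. h w \<partial>lborel) = (\<integral>v. (\<integral>t. indicator (slab e) v *\<^sub>R h (v + t *\<^sub>R e) \<partial>lborel) \<partial>lborel)" .
  show "integrable lborel (\<lambda>v. (\<integral>t. indicator (slab e) v *\<^sub>R h (v + t *\<^sub>R e) \<partial>lborel))"
    using lborel_pair.integrable_fst'[OF i] by simp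
qed

text \<open>The prism in the definition is swept by lines in direction \<open>e\<close> instead of
  \<open>n\<close>. Substituting the height \<open>s\<close> over the hyperplane gives the factor
  \<open>1 / \<bar>e \<bullet> n\<bar>\<close>. The orthogonal foot point then drifts linearly in
  \<open>s\<close>, and this drift is removed by a translation that maps the slab to itself; the
  remaining integral over \<open>s\<close> in [0,1] is 1.\<close>

lemma hyperplane_measure_oblique:
  fixes p n e :: "'a::euclidean_space"
  assumes n: "n \<bullet> n = 1" and e: "e \<bullet> e = 1" and ne: "e \<bullet> n \<noteq> 0"
  shows "hyperplane_measure p n =
    distr (density lborel (\<lambda>v. ennreal (indicator (slab e) v / \<bar>e \<bullet> n\<bar>))) lborel
      (\<lambda>v. v - (((v - p) \<bullet> n) / (e \<bullet> n)) *\<^sub>R e)" (is "_ = distr ?D lborel ?Q")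
proof (rule measure_eqI)
  show "sets (hyperplane_measure p n) = sets (distr ?D lborel ?Q)"
    by (simp add: hyperplane_measure_def)
  fix B assume "B \<in> sets (hyperplane_measure p n)"
  then have B [measurable]: "B \<in> sets borel" by (simp add: hyperplane_measure_def)
  define S where "S = {p + u + t *\<^sub>R n | u t. u \<bullet> n = 0 \<and> t \<in> {0..1}}"
  let ?P = "\<lambda>v. v - ((v - p) \<bullet> n) *\<^sub>R n"
  have S_iff: "v \<in> S \<longleftrightarrow> (v - p) \<bullet> n \<in> {0..1}" for v
  proof
    assume "v \<in> S" then show "(v - p) \<bullet> n \<in> {0..1}"
      by (auto simp: S_def inner_add_left n)
  next
    assume *: "(v - p) \<bullet> n \<in> {0..1}"
    have "v = p + ((v - p) - ((v - p) \<bullet> n) *\<^sub>R n) + ((v - p) \<bullet> n) *\<^sub>R n" by simp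
    moreover have "((v - p) - ((v - p) \<bullet> n) *\<^sub>R n) \<bullet> n = 0" by (simp add: inner_diff_left n)
    ultimately show "v \<in> S" using * unfolding S_def by blast
  qed
  have "closed {v. (v - p) \<bullet> n \<in> {0..1}}"
    by (auto intro!: closed_Collect_conj closed_Collect_le continuous_intros)
  moreover have "S = {v. (v - p) \<bullet> n \<in> {0..1}}" using S_iff by auto
  ultimately have [measurable]: "S \<in> sets borel" by simp
  \<comment> \<open>Moving along \<open>e\<close> until the height over the hyperplane has grown by
    one displaces the orthogonal foot point by \<open>c\<close>, the component of
    \<open>(1 / (e \<bullet> n)) *\<^sub>R e\<close> orthogonal to \<open>n\<close>.\<close>
  define c where "c = (1 / (e \<bullet> n)) *\<^sub>R e - n"
  have cn: "c \<bullet> n = 0" using ne by (simp add: c_def inner_diff_left n)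
  have Q0: "?P (v + (- ((v - p) \<bullet> n) / (e \<bullet> n) + (1 / (e \<bullet> n)) * s) *\<^sub>R e) = ?Q v + s *\<^sub>R c" for v s
  proof -
    have "(v + (- ((v - p) \<bullet> n) / (e \<bullet> n) + (1 / (e \<bullet> n)) * s) *\<^sub>R e - p) \<bullet> n = s"
      using ne by (simp add: inner_diff_left inner_add_left field_simps)
    then have "?P (v + (- ((v - p) \<bullet> n) / (e \<bullet> n) + (1 / (e \<bullet> n)) * s) *\<^sub>R e)
        = v + (- ((v - p) \<bullet> n) / (e \<bullet> n) + (1 / (e \<bullet> n)) * s) *\<^sub>R e - s *\<^sub>R n"
      by (simp only:)
    also have "\<dots> = ?Q v + s *\<^sub>R c"
      by (simp add: c_def scaleR_add_left scaleR_diff_left scaleR_diff_right)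
    finally show ?thesis .
  qed
  have S0: "v + (- ((v - p) \<bullet> n) / (e \<bullet> n) + (1 / (e \<bullet> n)) * s) *\<^sub>R e \<in> S \<longleftrightarrow> s \<in> {0..1}" for v s
    unfolding S_iff using ne by (simp add: inner_diff_left inner_add_left field_simps)
  \<comment> \<open>\<open>?Q\<close> ignores multiples of \<open>e\<close>, so the displacement may
    be corrected along \<open>e\<close> to become orthogonal to \<open>e\<close>; it then preserves
    the slab.\<close>
  have Qc: "?Q v + s *\<^sub>R c = ?Q (v + s *\<^sub>R c - s *\<^sub>R (c \<bullet> e) *\<^sub>R e)" for v s
  proof -
    have *: "((v + s *\<^sub>R c - s *\<^sub>R (c \<bullet> e) *\<^sub>R e - p) \<bullet> n) = (v - p) \<bullet> n - s * (c \<bullet> e) * (e \<bullet> n)"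
      by (simp add: inner_diff_left inner_add_left cn)
    show ?thesis unfolding * using ne by (simp add: diff_divide_distrib scaleR_diff_left)
  qed
  have slab_shift: "v + s *\<^sub>R c - s *\<^sub>R (c \<bullet> e) *\<^sub>R e \<in> slab e \<longleftrightarrow> v \<in> slab e" for v s
    by (simp add: slab_def inner_diff_left inner_add_left e)
  have "emeasure (hyperplane_measure p n) B = (\<integral>\<^sup>+z. indicator B z \<partial>hyperplane_measure p n)"
    by (simp add: hyperplane_measure_def)
  also have "\<dots> = (\<integral>\<^sup>+z. indicator B (?P z) \<partial>density lborel (indicator S))"
    unfolding hyperplane_measure_def S_def[symmetric] by (rule nn_integral_distr) auto
  also have "\<dots> = (\<integral>\<^sup>+v. indicator S v * indicator B (?P v) \<partial>lborel)"
    by (rule nn_integral_density) measurable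
  also have "\<dots> = (\<integral>\<^sup>+v. indicator (slab e) v *
      (\<integral>\<^sup>+t. indicator S (v + t *\<^sub>R e) * indicator B (?P (v + t *\<^sub>R e)) \<partial>lborel) \<partial>lborel)"
    by (rule nn_integral_oblique[OF _ e, symmetric]) measurable
  also have "\<dots> = (\<integral>\<^sup>+v. indicator (slab e) v *
      (ennreal (1 / \<bar>e \<bullet> n\<bar>) * (\<integral>\<^sup>+s. indicator {0..1} s * indicator B (?Q v + s *\<^sub>R c) \<partial>lborel)) \<partial>lborel)"
  proof (intro nn_integral_cong arg_cong2[where f = "(*)"] refl)
    fix v
    \<comment> \<open>The shift is the parameter at which the line meets the hyperplane, and
      \<open>s\<close> is the signed height above it.\<close>
    have "(\<integral>\<^sup>+t. indicator S (v + t *\<^sub>R e) * indicator B (?P (v + t *\<^sub>R e)) \<partial>lborel)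
      = ennreal \<bar>1 / (e \<bullet> n)\<bar> * (\<integral>\<^sup>+s. (\<lambda>t. indicator S (v + t *\<^sub>R e) * indicator B (?P (v + t *\<^sub>R e)))
           (- ((v - p) \<bullet> n) / (e \<bullet> n) + (1 / (e \<bullet> n)) * s) \<partial>lborel)"
      by (rule nn_integral_real_affine) (use ne in auto)
    also have "\<dots> = ennreal (1 / \<bar>e \<bullet> n\<bar>) * (\<integral>\<^sup>+s. indicator {0..1} s * indicator B (?Q v + s *\<^sub>R c) \<partial>lborel)"
      unfolding Q0 using S0 by (simp add: indicator_def)
    finally show "(\<integral>\<^sup>+t. indicator S (v + t *\<^sub>R e) * indicator B (?P (v + t *\<^sub>R e)) \<partial>lborel) = \<dots>" .
  qed
  also have "\<dots> = ennreal (1 / \<bar>e \<bullet> n\<bar>) * (\<integral>\<^sup>+v. indicator (slab e) v * (\<integral>\<^sup>+s. indicator {0..1} s * indicator B (?Q v + s *\<^sub>R c) \<partial>lborel) \<partial>lborel)"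
    by (simp only: mult.left_commute[of "indicator (slab e) _"]) (rule nn_integral_cmult, measurable)
  also have "(\<integral>\<^sup>+v. indicator (slab e) v * (\<integral>\<^sup>+s. indicator {0..1} s * indicator B (?Q v + s *\<^sub>R c) \<partial>lborel) \<partial>lborel)
      = (\<integral>\<^sup>+v. (\<integral>\<^sup>+s. indicator (slab e) v * (indicator {0..1} s * indicator B (?Q v + s *\<^sub>R c)) \<partial>lborel) \<partial>lborel)"
    by (simp add: nn_integral_cmult)
  also have "(\<integral>\<^sup>+v. (\<integral>\<^sup>+s. indicator (slab e) v * (indicator {0..1} s * indicator B (?Q v + s *\<^sub>R c)) \<partial>lborel) \<partial>lborel)
     = (\<integral>\<^sup>+s. (\<integral>\<^sup>+v. indicator (slab e) v * (indicator {0..1} s * indicator B (?Q v + s *\<^sub>R c)) \<partial>lborel) \<partial>lborel)"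
    by (rule lborel_pair.Fubini') measurable
  also have "\<dots> = (\<integral>\<^sup>+s. indicator {0..1::real} s * (\<integral>\<^sup>+v. indicator (slab e) v * indicator B (?Q v) \<partial>lborel) \<partial>lborel)"
  proof (rule nn_integral_cong)
    fix s :: real
    let ?k = "\<lambda>v. indicator (slab e) v * indicator B (?Q v) :: ennreal"
    have "(\<integral>\<^sup>+v. indicator (slab e) v * (indicator {0..1} s * indicator B (?Q v + s *\<^sub>R c)) \<partial>lborel)
      = indicator {0..1} s * (\<integral>\<^sup>+v. indicator (slab e) v * indicator B (?Q v + s *\<^sub>R c) \<partial>lborel)"
      by (simp only: mult.left_commute[of "indicator (slab e) _"]) (rule nn_integral_cmult, measurable)
    also have "(\<integral>\<^sup>+v. indicator (slab e) v * indicator B (?Q v + s *\<^sub>R c) \<partial>lborel)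
      = (\<integral>\<^sup>+v. ?k (v + (s *\<^sub>R c - s *\<^sub>R (c \<bullet> e) *\<^sub>R e)) \<partial>lborel)"
      unfolding Qc using slab_shift by (simp add: add_diff_eq indicator_def)
    also have "\<dots> = (\<integral>\<^sup>+v. ?k v \<partial>lborel)"
      by (rule nn_integral_lborel_translate) measurable
    finally show "(\<integral>\<^sup>+v. indicator (slab e) v * (indicator {0..1} s * indicator B (?Q v + s *\<^sub>R c)) \<partial>lborel)
      = indicator {0..1} s * (\<integral>\<^sup>+v. indicator (slab e) v * indicator B (?Q v) \<partial>lborel)" .
  qed
  also have "\<dots> = (\<integral>\<^sup>+v. indicator (slab e) v * indicator B (?Q v) \<partial>lborel)"
    by (subst nn_integral_multc) auto
  also have "ennreal (1 / \<bar>e \<bullet> n\<bar>) * \<dots> = (\<integral>\<^sup>+v. ennreal (indicator (slab e) v / \<bar>e \<bullet> n\<bar>) * indicator B (?Q v) \<partial>lborel)"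
    by (subst nn_integral_cmult[symmetric]) (auto intro!: nn_integral_cong simp: indicator_def)
  also have "\<dots> = (\<integral>\<^sup>+z. indicator B (?Q z) \<partial>?D)"
    by (rule nn_integral_density[symmetric]) measurable
  also have "\<dots> = (\<integral>\<^sup>+z. indicator B z \<partial>distr ?D lborel ?Q)"
    by (rule nn_integral_distr[symmetric]) auto
  also have "\<dots> = emeasure (distr ?D lborel ?Q) B" by simp
  finally show "emeasure (hyperplane_measure p n) B = emeasure (distr ?D lborel ?Q) B" .
qed

section \<open>Differentiation of integrals over moving intervals\<close>

lemma linear_norm_le_Basis:
  fixes L :: "'a::euclidean_space \<Rightarrow> 'b::real_normed_vector"
  assumes "linear L"
  shows "norm (L h) \<le> (\<Sum>b\<in>Basis. norm (L b)) * norm h"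
proof -
  have "L h = L (\<Sum>b\<in>Basis. (h \<bullet> b) *\<^sub>R b)" by (simp add: euclidean_representation)
  also have "\<dots> = (\<Sum>b\<in>Basis. (h \<bullet> b) *\<^sub>R L b)"
    using assms by (simp add: linear_sum linear_scale)
  also have "norm \<dots> \<le> (\<Sum>b\<in>Basis. norm h * norm (L b))"
    by (intro sum_norm_le) (auto intro!: mult_right_mono Basis_le_norm)
  finally show ?thesis by (simp add: sum_distrib_left mult.commute)
qed

text \<open>Sequences suffice for the limit within \<open>S\<close>. The difference quotients are
  dominated by \<open>K\<close> plus a bound for the operator \<open>D v\<close>; the latter is a
  sum over the finite basis, integrable because each \<open>\<lambda>v. D v h\<close> is.
  \<open>lip\<close> compares with the base point \<open>x\<close> only.\<close>

lemma has_derivative_integral_dominated: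
  fixes J :: "'a::euclidean_space \<Rightarrow> 'v \<Rightarrow> 'b::{banach, second_countable_topology}"
  assumes deriv: "AE v in M. ((\<lambda>y. J y v) has_derivative D v) (at x within S)"
    and lin: "\<And>v. linear (D v)"
    and x: "x \<in> S"
    and J: "\<And>y. y \<in> S \<Longrightarrow> integrable M (J y)"
    and D: "\<And>h. integrable M (\<lambda>v. D v h)"
    and lip: "\<And>y v. y \<in> S \<Longrightarrow> norm (J y v - J x v) \<le> K v * norm (y - x)"
    and K: "integrable M K"
  shows "((\<lambda>y. \<integral>v. J y v \<partial>M) has_derivative (\<lambda>h. \<integral>v. D v h \<partial>M)) (at x within S)"
  unfolding has_derivative_at_within
proof
  have "linear (\<lambda>h. \<integral>v. D v h \<partial>M)"
    by (rule linearI) (simp_all add: linear_add[OF lin] linear_scale[OF lin] D)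
  then show "bounded_linear (\<lambda>h. \<integral>v. D v h \<partial>M)" by (rule linear_conv_bounded_linear[THEN iffD1])
  let ?K = "\<lambda>v. \<Sum>b\<in>Basis. norm (D v b)"
  show "((\<lambda>y. ((\<integral>v. J y v \<partial>M) - (\<integral>v. J x v \<partial>M) - (\<integral>v. D v (y - x) \<partial>M)) /\<^sub>R norm (y - x)) \<longlongrightarrow> 0) (at x within S)"
    unfolding tendsto_at_iff_sequentially
  proof (intro allI impI)
    fix X assume X: "\<forall>i. X i \<in> S - {x}" and Xx: "X \<longlonglongrightarrow> x"
    let ?q = "\<lambda>i v. (J (X i) v - J x v - D v (X i - x)) /\<^sub>R norm (X i - x)"
    have q_int: "integrable M (?q i)" for i
      using X J x D by (intro integrable_scaleR_right integrable_diff) auto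
    have "(\<lambda>i. \<integral>v. ?q i v \<partial>M) \<longlonglongrightarrow> (\<integral>v. 0 \<partial>M)"
    proof (rule integral_dominated_convergence)
      show "integrable M (\<lambda>v. K v + ?K v)" using K D by simp
      show "AE v in M. (\<lambda>i. ?q i v) \<longlonglongrightarrow> 0"
        using deriv
      proof eventually_elim
        case (elim v)
        then show ?case
          using X Xx unfolding has_derivative_at_within tendsto_at_iff_sequentially by (auto simp: comp_def)
      qed
      show "AE v in M. norm (?q i v) \<le> K v + ?K v" for i
      proof (intro AE_I2)
        fix v
        have pos: "norm (X i - x) > 0" using X by auto
        have "norm (J (X i) v - J x v - D v (X i - x)) \<le> K v * norm (X i - x) + ?K v * norm (X i - x)"
          using X by (intro order_trans[OF norm_triangle_ineq4] add_mono lip linear_norm_le_Basis lin) auto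
        also have "\<dots> = (K v + ?K v) * norm (X i - x)" by (simp add: distrib_right)
        finally have "norm (J (X i) v - J x v - D v (X i - x)) / norm (X i - x) \<le> K v + ?K v"
          using pos by (simp only: pos_divide_le_eq)
        then show "norm (?q i v) \<le> K v + ?K v"
          by (simp only: norm_scaleR abs_inverse abs_norm_cancel divide_inverse mult.commute)
      qed
    qed (use q_int in auto)
    moreover have "(\<integral>v. ?q i v \<partial>M)
      = ((\<integral>v. J (X i) v \<partial>M) - (\<integral>v. J x v \<partial>M) - (\<integral>v. D v (X i - x) \<partial>M)) /\<^sub>R norm (X i - x)" for i
    proof -
      have *: "integrable M (J (X i))" "integrable M (J x)" "integrable M (\<lambda>v. D v (X i - x))"
        using X J x D by auto
      show ?thesis
        unfolding integral_scaleR_right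
          Bochner_Integration.integral_diff[OF Bochner_Integration.integrable_diff[OF *(1,2)] *(3)]
          Bochner_Integration.integral_diff[OF *(1,2)] ..
    qed
    ultimately show "((\<lambda>y. ((\<integral>v. J y v \<partial>M) - (\<integral>v. J x v \<partial>M) - (\<integral>v. D v (y - x) \<partial>M)) /\<^sub>R norm (y - x)) \<circ> X) \<longlonglongrightarrow> 0"
      by (simp only: comp_def Bochner_Integration.integral_zero)
  qed
qed

section \<open>One-dimensional integrals over intervals with moving endpoints\<close>

lemma integrable_continuous_bounded:
  fixes g :: "'a::euclidean_space \<Rightarrow> 'b::euclidean_space"
  assumes "continuous_on UNIV g" "B \<in> sets borel" "B \<subseteq> C" "compact C"
  shows "integrable lborel (\<lambda>t. indicator B t *\<^sub>R g t)"
proof -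
  have "set_integrable lborel C g"
    unfolding set_integrable_def
    by (rule borel_integrable_compact[OF assms(4) continuous_on_subset[OF assms(1)]]) auto
  then have "set_integrable lborel B g"
    by (rule set_integrable_subset) (use assms in auto)
  then show ?thesis by (simp add: set_integrable_def)
qed

text \<open>A primitive of \<open>g\<close> set to zero outside [0,1]. It stays constant once a
  moving endpoint leaves [0,1], so differentiability can fail only at 0 and 1.\<close>

definition cutoff_integral :: "(real \<Rightarrow> 'b::euclidean_space) \<Rightarrow> real \<Rightarrow> 'b" where
  "cutoff_integral g s = (\<integral>t. indicator ({0..1} \<inter> {..s}) t *\<^sub>R g t \<partial>lborel)"

lemma cutoff_integral_eq:
  assumes "continuous_on UNIV g"
  shows "cutoff_integral g s = integral ({0..1} \<inter> {..s}) g"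
proof -
  have "set_integrable lborel ({0..1} \<inter> {..s}) g"
    unfolding set_integrable_def by (rule integrable_continuous_bounded[OF assms, where C="{0..1}"]) auto
  from set_borel_integral_eq_integral(2)[OF this] show ?thesis
    by (simp add: cutoff_integral_def set_lebesgue_integral_def)
qed

lemma cutoff_integral_deriv:
  fixes g :: "real \<Rightarrow> 'b::euclidean_space"
  assumes g: "continuous_on UNIV g" and s: "s \<noteq> 0" "s \<noteq> 1"
  shows "(cutoff_integral g has_vector_derivative (indicator {0..1} s *\<^sub>R g s)) (at s)"
proof -
  consider "s < 0" | "s > 1" | "0 < s" "s < 1" using s by linarith
  then show ?thesis
  proof cases
    case 1
    have "((\<lambda>s. 0) has_vector_derivative (0::'b)) (at s)" by simp
    then have "(cutoff_integral g has_vector_derivative 0) (at s)"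
      by (rule has_vector_derivative_transform_within_open[where S="{..<0}"])
        (use 1 in \<open>auto simp: cutoff_integral_eq[OF g]\<close>)
    then show ?thesis using 1 by simp
  next
    case 2
    have eq: "{0..1} \<inter> {..y} = {0..1}" if "y > 1" for y :: real using that by auto
    have "((\<lambda>s. integral {0..1} g) has_vector_derivative (0::'b)) (at s)" by simp
    then have "(cutoff_integral g has_vector_derivative 0) (at s)"
      by (rule has_vector_derivative_transform_within_open[where S="{1<..}"])
        (use 2 in \<open>auto simp: cutoff_integral_eq[OF g] eq\<close>)
    then show ?thesis using 2 by simp
  next
    case 3
    have eq: "{0..1} \<inter> {..y} = {0..y}" if "y < 1" for y :: real using that by auto
    have "((\<lambda>u. integral {0..u} g) has_vector_derivative g s) (at s within {0..1})"
      by (rule integral_has_vector_derivative) (use 3 g continuous_on_subset in auto)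
    then have "((\<lambda>u. integral {0..u} g) has_vector_derivative g s) (at s within {0<..<1})"
      by (rule has_vector_derivative_within_subset) auto
    then have "((\<lambda>u. integral {0..u} g) has_vector_derivative g s) (at s)"
      using 3 by (simp add: at_within_open[of s "{0<..<1}"])
    then have "(cutoff_integral g has_vector_derivative g s) (at s)"
      by (rule has_vector_derivative_transform_within_open[where S="{0<..<1}"])
        (use 3 in \<open>auto simp: cutoff_integral_eq[OF g] eq\<close>)
    then show ?thesis using 3 by simp
  qed
qed

text \<open>The sign of \<open>\<sigma>\<close> selects the side of the endpoint
  \<open>\<tau>\<close>, so that an interval is a product of such factors and its endpoints need not
  be sorted. Both orientations are closed; the value at \<open>\<tau>\<close> itself is 1.\<close>

definition half_line :: "real \<Rightarrow> real \<Rightarrow> real \<Rightarrow> real" where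
  "half_line \<sigma> \<tau> t = of_bool (0 \<le> \<sigma> * (t - \<tau>))"

lemma half_line_bounds: "0 \<le> half_line \<sigma> \<tau> t" "half_line \<sigma> \<tau> t \<le> 1" "norm (half_line \<sigma> \<tau> t) \<le> 1"
  by (auto simp: half_line_def)

lemma half_line_measurable [measurable]: "half_line \<sigma> \<tau> \<in> borel_measurable borel"
  unfolding half_line_def by measurable

lemma half_line_integrable:
  fixes g :: "real \<Rightarrow> 'b::euclidean_space"
  assumes g: "continuous_on UNIV g"
  shows "integrable lborel (\<lambda>t. (indicator {0..1} t * (\<Prod>k\<in>K. half_line (\<sigma> k) (\<tau> k) t)) *\<^sub>R g t)"
proof (rule Bochner_Integration.integrable_bound)
  show "integrable lborel (\<lambda>t. indicator {0..1} t *\<^sub>R g t)"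
    by (rule integrable_continuous_bounded[OF g, where C="{0..1}"]) auto
  have [measurable]: "g \<in> borel_measurable borel" using g by (rule borel_measurable_continuous_onI)
  show "(\<lambda>t. (indicator {0..1} t * (\<Prod>k\<in>K. half_line (\<sigma> k) (\<tau> k) t)) *\<^sub>R g t) \<in> borel_measurable lborel"
    by measurable
  have "\<bar>\<Prod>k\<in>K. half_line (\<sigma> k) (\<tau> k) t\<bar> \<le> 1" for t
    by (simp add: abs_prod) (intro prod_le_1, auto simp: half_line_bounds)
  then show "AE t in lborel. norm ((indicator {0..1} t * (\<Prod>k\<in>K. half_line (\<sigma> k) (\<tau> k) t)) *\<^sub>R g t)
      \<le> norm (indicator {0..1} t *\<^sub>R g t :: 'b)"
    by (intro AE_I2) (auto simp: abs_mult indicator_def intro: mult_left_le_one_le)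
qed

text \<open>For positive \<open>\<sigma>\<close> the half line is 1 minus the one reaching to minus
  infinity, and the 1 cancels in the difference; this is the origin of
  \<open>- sgn \<sigma>\<close>. The endpoints are excluded because both orientations are
  closed.\<close>

lemma half_line_diff_integral:
  fixes g :: "real \<Rightarrow> 'b::euclidean_space"
  assumes g: "continuous_on UNIV g" and \<sigma>: "\<sigma> \<noteq> 0"
  shows "(\<integral>t. (indicator {0..1} t * (half_line \<sigma> \<tau> t - half_line \<sigma> \<rho> t)) *\<^sub>R g t \<partial>lborel)
    = - sgn \<sigma> *\<^sub>R (cutoff_integral g \<tau> - cutoff_integral g \<rho>)"
proof -
  have [measurable]: "g \<in> borel_measurable borel" using g by (rule borel_measurable_continuous_onI)
  have int: "integrable lborel (\<lambda>t. indicator ({0..1} \<inter> {..s}) t *\<^sub>R g t)" for s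
    by (rule integrable_continuous_bounded[OF g, where C="{0..1}"]) auto
  have "AE t in lborel. t \<notin> {\<tau>, \<rho>}"
    by (intro AE_not_in finite_imp_null_set_lborel) simp
  then have "AE t in lborel. (indicator {0..1} t * (half_line \<sigma> \<tau> t - half_line \<sigma> \<rho> t)) *\<^sub>R g t
     = - sgn \<sigma> *\<^sub>R (indicator ({0..1} \<inter> {..\<tau>}) t *\<^sub>R g t - indicator ({0..1} \<inter> {..\<rho>}) t *\<^sub>R g t)"
  proof eventually_elim
    case (elim t)
    then show ?case
      using \<sigma> by (cases "\<sigma> > 0")
        (auto simp: half_line_def indicator_def sgn_if zero_le_mult_iff not_less algebra_simps)
  qed
  then have "(\<integral>t. (indicator {0..1} t * (half_line \<sigma> \<tau> t - half_line \<sigma> \<rho> t)) *\<^sub>R g t \<partial>lborel)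
    = (\<integral>t. - sgn \<sigma> *\<^sub>R (indicator ({0..1} \<inter> {..\<tau>}) t *\<^sub>R g t - indicator ({0..1} \<inter> {..\<rho>}) t *\<^sub>R g t) \<partial>lborel)"
    by (intro integral_cong_AE) auto
  also have "\<dots> = - sgn \<sigma> *\<^sub>R (cutoff_integral g \<tau> - cutoff_integral g \<rho>)"
    unfolding cutoff_integral_def
    by (subst integral_scaleR_right, subst Bochner_Integration.integral_diff) (use int in auto)
  finally show ?thesis .
qed

lemma half_line_diff_le:
  assumes "\<sigma> \<noteq> 0"
  shows "\<bar>half_line \<sigma> \<tau> t - half_line \<sigma> \<rho> t\<bar> \<le> indicator {min \<tau> \<rho>..max \<tau> \<rho>} t"
  using assms by (cases "\<sigma> > 0") (auto simp: half_line_def indicator_def zero_le_mult_iff)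

text \<open>The gap between \<open>t\<close> and \<open>\<rho>\<close> exceeds the displacement of
  the endpoint and that of the point, so neither replacement changes sides. The case
  \<open>s = t\<close> compares two positions of an endpoint; taking for \<open>s\<close> a
  neighbouring endpoint freezes a cofactor.\<close>

lemma half_line_eq:
  assumes "\<bar>\<tau> - \<rho>\<bar> < \<bar>t - \<rho>\<bar>" "\<bar>s - t\<bar> < \<bar>t - \<rho>\<bar>"
  shows "half_line \<sigma> \<tau> t = half_line \<sigma> \<rho> s"
  using assms by (auto simp: half_line_def zero_le_mult_iff)

text \<open>Two distinct endpoints never move past the same point at once, so near a configuration with
  distinct endpoints the difference of the products telescopes with constant cofactors.\<close>

lemma prod_half_line_diff:
  assumes K: "finite K"
    and sep: "\<And>k l. k \<in> K \<Longrightarrow> l \<in> K \<Longrightarrow> k \<noteq> l \<Longrightarrow> 2 * \<delta> < \<bar>\<rho> k - \<rho> l\<bar>"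
    and near: "\<And>k. k \<in> K \<Longrightarrow> \<bar>\<tau> k - \<rho> k\<bar> < \<delta>"
  shows "(\<Prod>k\<in>K. half_line (\<sigma> k) (\<tau> k) t) - (\<Prod>k\<in>K. half_line (\<sigma> k) (\<rho> k) t)
    = (\<Sum>k\<in>K. (\<Prod>l\<in>K - {k}. half_line (\<sigma> l) (\<rho> l) (\<rho> k)) *
        (half_line (\<sigma> k) (\<tau> k) t - half_line (\<sigma> k) (\<rho> k) t))"
proof (cases "\<exists>k\<in>K. \<bar>t - \<rho> k\<bar> < \<delta>")
  case True
  then obtain k where k: "k \<in> K" "\<bar>t - \<rho> k\<bar> < \<delta>" by auto
  have far: "\<delta> < \<bar>t - \<rho> l\<bar>" if "l \<in> K" "l \<noteq> k" for l
    using sep[OF k(1) that(1) that(2)[symmetric]] k(2) by linarith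
  have eq: "half_line (\<sigma> l) (\<tau> l) t = half_line (\<sigma> l) (\<rho> l) (\<rho> k)"
      "half_line (\<sigma> l) (\<rho> l) t = half_line (\<sigma> l) (\<rho> l) (\<rho> k)"
    if "l \<in> K - {k}" for l
    using far[of l] near[of l] that k by (auto intro!: half_line_eq)
  have zero: "half_line (\<sigma> l) (\<tau> l) t - half_line (\<sigma> l) (\<rho> l) t = 0" if "l \<in> K - {k}" for l
    using eq[OF that] by simp
  show ?thesis
    using eq by (simp add: prod.remove[OF K k(1)] sum.remove[OF K k(1)] zero algebra_simps)
next
  case False
  then have "half_line (\<sigma> k) (\<tau> k) t = half_line (\<sigma> k) (\<rho> k) t" if "k \<in> K" for k
    using near[OF that] that by (intro half_line_eq) force+
  then show ?thesis by simp
qed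

text \<open>The cofactor at \<open>\<tau> k x\<close> decides whether this candidate is a true
  endpoint: if another half line excludes it, the term vanishes. The factor
  \<open>- sgn (\<sigma> k)\<close> is -1 for a left endpoint and 1 for a right one.\<close>

lemma interval_integral_deriv:
  fixes \<tau> :: "'k \<Rightarrow> 'a::real_normed_vector \<Rightarrow> real" and g :: "real \<Rightarrow> 'b::euclidean_space"
  assumes K: "finite K" and g: "continuous_on UNIV g"
    and \<tau>: "\<And>k. k \<in> K \<Longrightarrow> (\<tau> k has_derivative \<tau>' k) (at x within S)"
    and dist: "\<And>k l. k \<in> K \<Longrightarrow> l \<in> K \<Longrightarrow> k \<noteq> l \<Longrightarrow> \<tau> k x \<noteq> \<tau> l x"
    and ends: "\<And>k. k \<in> K \<Longrightarrow> \<tau> k x \<noteq> 0" "\<And>k. k \<in> K \<Longrightarrow> \<tau> k x \<noteq> 1"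
    and \<sigma>: "\<And>k. k \<in> K \<Longrightarrow> \<sigma> k \<noteq> 0" and x: "x \<in> S"
  shows "((\<lambda>y. \<integral>t. (indicator {0..1} t * (\<Prod>k\<in>K. half_line (\<sigma> k) (\<tau> k y) t)) *\<^sub>R g t \<partial>lborel)
    has_derivative (\<lambda>h. \<Sum>k\<in>K. (indicator {0..1} (\<tau> k x) * (\<Prod>l\<in>K - {k}. half_line (\<sigma> l) (\<tau> l x) (\<tau> k x)) *
       (- sgn (\<sigma> k) * \<tau>' k h)) *\<^sub>R g (\<tau> k x))) (at x within S)"
    (is "(?J has_derivative ?D) _")
proof -
  have [measurable]: "g \<in> borel_measurable borel" using g by (rule borel_measurable_continuous_onI)
  define c where "c k = (\<Prod>l\<in>K - {k}. half_line (\<sigma> l) (\<tau> l x) (\<tau> k x))" for k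
  let ?A = "\<lambda>y. ?J x + (\<Sum>k\<in>K. (- sgn (\<sigma> k) * c k) *\<^sub>R (cutoff_integral g (\<tau> k y) - cutoff_integral g (\<tau> k x)))"
  obtain \<delta> where \<delta>: "\<delta> > 0" and sep: "\<And>k l. k \<in> K \<Longrightarrow> l \<in> K \<Longrightarrow> k \<noteq> l \<Longrightarrow> 2 * \<delta> < \<bar>\<tau> k x - \<tau> l x\<bar>"
  proof -
    \<comment> \<open>The inserted 1 keeps the set nonempty when \<open>K\<close> has fewer than two
      elements; a third of the minimum makes twice \<open>\<delta>\<close> strictly smaller than
      every gap.\<close>
    let ?d = "insert 1 ((\<lambda>(k,l). \<bar>\<tau> k x - \<tau> l x\<bar>) ` {p \<in> K \<times> K. fst p \<noteq> snd p})"
    have fin: "finite ?d" using K by auto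
    then have "Min ?d > 0" using dist by (subst Min_gr_iff) auto
    moreover have "Min ?d \<le> \<bar>\<tau> k x - \<tau> l x\<bar>" if "k \<in> K" "l \<in> K" "k \<noteq> l" for k l
      using fin that by (intro Min_le) (auto intro!: image_eqI[where x="(k,l)"])
    ultimately show ?thesis by (intro that[of "Min ?d / 3"]) (auto, smt (verit))
  qed
  have int: "integrable lborel (\<lambda>t. (indicator {0..1} t * (\<Prod>k\<in>L. half_line (\<sigma> k) (\<tau> k y) t)) *\<^sub>R g t)" for L y
    by (rule half_line_integrable[OF g])
  have ev: "eventually (\<lambda>y. \<forall>k\<in>K. \<bar>\<tau> k y - \<tau> k x\<bar> < \<delta>) (at x within S)"
  proof (intro eventually_ball_finite[OF K] ballI)
    fix k assume "k \<in> K"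
    then have "(\<tau> k \<longlongrightarrow> \<tau> k x) (at x within S)"
      using \<tau> has_derivative_continuous continuous_within by blast
    from tendstoD[OF this \<delta>] show "\<forall>\<^sub>F y in at x within S. \<bar>\<tau> k y - \<tau> k x\<bar> < \<delta>"
      by (simp add: dist_real_def)
  qed
  have 1: "eventually (\<lambda>y. ?A y = ?J y) (at x within S)"
    using ev
  proof eventually_elim
    case (elim y)
    have one: "integrable lborel (\<lambda>t. (indicator {0..1} t * half_line (\<sigma> k) s t) *\<^sub>R g t)" for k s
      using half_line_integrable[OF g, where K="{k}" and \<sigma>=\<sigma> and \<tau>="\<lambda>_. s"] by simp
    have diff: "integrable lborel (\<lambda>t. (indicator {0..1} t * (half_line (\<sigma> k) (\<tau> k y) t - half_line (\<sigma> k) (\<tau> k x) t)) *\<^sub>R g t)" for k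
      using Bochner_Integration.integrable_diff[OF one[of k "\<tau> k y"] one[of k "\<tau> k x"]]
      by (simp add: algebra_simps)
    have "?J y - ?J x = (\<integral>t. (indicator {0..1} t * (\<Prod>k\<in>K. half_line (\<sigma> k) (\<tau> k y) t)) *\<^sub>R g t
        - (indicator {0..1} t * (\<Prod>k\<in>K. half_line (\<sigma> k) (\<tau> k x) t)) *\<^sub>R g t \<partial>lborel)"
      by (rule Bochner_Integration.integral_diff[symmetric]) (rule int)+
    also have "\<dots> = (\<integral>t. (\<Sum>k\<in>K. c k *\<^sub>R (indicator {0..1} t * (half_line (\<sigma> k) (\<tau> k y) t - half_line (\<sigma> k) (\<tau> k x) t)) *\<^sub>R g t) \<partial>lborel)"
    proof (rule Bochner_Integration.integral_cong[OF refl])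
      fix t
      have "(\<Prod>k\<in>K. half_line (\<sigma> k) (\<tau> k y) t) - (\<Prod>k\<in>K. half_line (\<sigma> k) (\<tau> k x) t)
        = (\<Sum>k\<in>K. c k * (half_line (\<sigma> k) (\<tau> k y) t - half_line (\<sigma> k) (\<tau> k x) t))"
        unfolding c_def by (rule prod_half_line_diff[OF K, where \<delta>=\<delta>]) (use sep elim in auto)
      then have "(indicator {0..1} t * ((\<Prod>k\<in>K. half_line (\<sigma> k) (\<tau> k y) t) - (\<Prod>k\<in>K. half_line (\<sigma> k) (\<tau> k x) t))) *\<^sub>R g t
         = (\<Sum>k\<in>K. c k *\<^sub>R (indicator {0..1} t * (half_line (\<sigma> k) (\<tau> k y) t - half_line (\<sigma> k) (\<tau> k x) t)) *\<^sub>R g t)"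
        by (simp add: sum_distrib_left scaleR_sum_left mult.left_commute)
      then show "(indicator {0..1} t * (\<Prod>k\<in>K. half_line (\<sigma> k) (\<tau> k y) t)) *\<^sub>R g t
        - (indicator {0..1} t * (\<Prod>k\<in>K. half_line (\<sigma> k) (\<tau> k x) t)) *\<^sub>R g t
        = (\<Sum>k\<in>K. c k *\<^sub>R (indicator {0..1} t * (half_line (\<sigma> k) (\<tau> k y) t - half_line (\<sigma> k) (\<tau> k x) t)) *\<^sub>R g t)"
        by (simp add: right_diff_distrib scaleR_diff_left)
    qed
    also have "\<dots> = (\<Sum>k\<in>K. c k *\<^sub>R (- sgn (\<sigma> k) *\<^sub>R (cutoff_integral g (\<tau> k y) - cutoff_integral g (\<tau> k x))))"
      using diff by (subst Bochner_Integration.integral_sum)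
        (auto intro!: sum.cong simp: half_line_diff_integral[OF g \<sigma>] simp del: scaleR_scaleR)
    finally have "?J y - ?J x = (\<Sum>k\<in>K. (- sgn (\<sigma> k) * c k) *\<^sub>R (cutoff_integral g (\<tau> k y) - cutoff_integral g (\<tau> k x)))"
      by (simp add: mult.commute)
    then show ?case by (simp add: algebra_simps)
  qed
  have 2: "(?A has_derivative ?D) (at x within S)"
  proof -
    have "((\<lambda>y. cutoff_integral g (\<tau> k y)) has_derivative (\<lambda>h. \<tau>' k h *\<^sub>R (indicator {0..1} (\<tau> k x) *\<^sub>R g (\<tau> k x)))) (at x within S)"
      if k: "k \<in> K" for k
      using has_derivative_compose[OF \<tau>[OF k], of "cutoff_integral g"]
        cutoff_integral_deriv[OF g ends[OF k]] unfolding has_vector_derivative_def by blast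
    then show ?thesis
      by (auto intro!: derivative_eq_intros sum.cong simp: c_def mult_ac)
  qed
  show ?thesis
    by (rule has_derivative_transform_eventually[OF 2 1 _ x]) simp
qed

text \<open>Products of numbers in [0,1] differ by at most the sum of the differences of their
  factors, and each such difference is carried by the interval between the two positions of the
  endpoint. The estimate stays valid when endpoints coincide or cross, so it provides the domination
  uniformly over all lines.\<close>

lemma interval_integral_lipschitz:
  fixes g :: "real \<Rightarrow> 'b::euclidean_space"
  assumes K: "finite K" and g: "continuous_on UNIV g"
    and bound: "\<And>t. t \<in> {0..1} \<Longrightarrow> norm (g t) \<le> C"
    and \<sigma>: "\<And>k. k \<in> K \<Longrightarrow> \<sigma> k \<noteq> 0"
  shows "norm ((\<integral>t. (indicator {0..1} t * (\<Prod>k\<in>K. half_line (\<sigma> k) (\<tau> k) t)) *\<^sub>R g t \<partial>lborel) -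
      (\<integral>t. (indicator {0..1} t * (\<Prod>k\<in>K. half_line (\<sigma> k) (\<rho> k) t)) *\<^sub>R g t \<partial>lborel))
    \<le> C * (\<Sum>k\<in>K. \<bar>\<tau> k - \<rho> k\<bar>)"
proof -
  let ?u = "\<lambda>\<tau> t. (indicator {0..1} t * (\<Prod>k\<in>K. half_line (\<sigma> k) (\<tau> k) t)) *\<^sub>R g t"
  have int: "integrable lborel (?u \<tau>)" for \<tau> by (rule half_line_integrable[OF g])
  have ii: "integrable lborel (indicator {a..b} :: real \<Rightarrow> real)" for a b :: real
    by (rule integrable_real_indicator) (simp, rule emeasure_bounded_finite, simp)
  have C: "0 \<le> C" using order_trans[OF norm_ge_zero bound[of 0]] by simp
  have "norm ((\<integral>t. ?u \<tau> t \<partial>lborel) - (\<integral>t. ?u \<rho> t \<partial>lborel)) = norm (\<integral>t. ?u \<tau> t - ?u \<rho> t \<partial>lborel)"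
    by (simp add: int)
  also have "\<dots> \<le> (\<integral>t. C * (\<Sum>k\<in>K. indicator {min (\<tau> k) (\<rho> k)..max (\<tau> k) (\<rho> k)} t) \<partial>lborel)"
  proof (rule Bochner_Integration.integral_norm_bound_integral)
    show "integrable lborel (\<lambda>t. ?u \<tau> t - ?u \<rho> t)" using int by (intro Bochner_Integration.integrable_diff)
    show "integrable lborel (\<lambda>t. C * (\<Sum>k\<in>K. indicator {min (\<tau> k) (\<rho> k)..max (\<tau> k) (\<rho> k)} t))"
      by (intro integrable_mult_right Bochner_Integration.integrable_sum ii)
    fix t :: real
    show "norm (?u \<tau> t - ?u \<rho> t) \<le> C * (\<Sum>k\<in>K. indicator {min (\<tau> k) (\<rho> k)..max (\<tau> k) (\<rho> k)} t)"
    proof (cases "t \<in> {0..1}")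
      case True
      have "norm (?u \<tau> t - ?u \<rho> t) = \<bar>(\<Prod>k\<in>K. half_line (\<sigma> k) (\<tau> k) t) - (\<Prod>k\<in>K. half_line (\<sigma> k) (\<rho> k) t)\<bar> * norm (g t)"
        using True by (simp flip: scaleR_diff_left)
      also have "\<dots> \<le> (\<Sum>k\<in>K. norm (half_line (\<sigma> k) (\<tau> k) t - half_line (\<sigma> k) (\<rho> k) t)) * C"
        using norm_prod_diff[of K "\<lambda>k. half_line (\<sigma> k) (\<tau> k) t" "\<lambda>k. half_line (\<sigma> k) (\<rho> k) t"]
        by (intro mult_mono bound True sum_nonneg) (auto simp: half_line_bounds)
      also have "\<dots> \<le> (\<Sum>k\<in>K. indicator {min (\<tau> k) (\<rho> k)..max (\<tau> k) (\<rho> k)} t) * C"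
        using half_line_diff_le[OF \<sigma>] by (intro mult_right_mono sum_mono C) auto
      finally show ?thesis by (simp add: mult.commute)
    next
      case False
      then show ?thesis using C by (auto intro!: mult_nonneg_nonneg sum_nonneg)
    qed
  qed
  also have "\<dots> = C * (\<Sum>k\<in>K. \<integral>t. indicator {min (\<tau> k) (\<rho> k)..max (\<tau> k) (\<rho> k)} t \<partial>lborel)"
    by (simp only: integral_mult_right_zero Bochner_Integration.integral_sum[OF ii])
  also have "\<dots> = C * (\<Sum>k\<in>K. \<bar>\<tau> k - \<rho> k\<bar>)"
  proof -
    have "(\<integral>t. indicator {min a b..max a b} t \<partial>lborel) = \<bar>a - b\<bar>" for a b :: real
      by (cases "a \<le> b") simp_all
    then show ?thesis by (simp only:)
  qed
  finally show ?thesis .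
qed

section \<open>Mediators and oblique projections\<close>

text \<open>The squares of \<open>w\<close> cancel, so this is affine in \<open>w\<close>: the
  mediator is its zero set, and it is nonnegative on the side of \<open>x$i\<close>.\<close>

definition sqdist_diff :: "(real^'d)^'i \<Rightarrow> 'i \<Rightarrow> 'i \<Rightarrow> real^'d \<Rightarrow> real" where
  "sqdist_diff x i k w = (norm (x$k - w))\<^sup>2 - (norm (x$i - w))\<^sup>2"

text \<open>Without tie-breaking the labels \<open>\<iota>\<close> disappear. On
  \<open>config_D\<close> it is the closure of \<open>voronoi_cell\<close> and differs from it by a
  null set.\<close>

definition closed_cell :: "(real^'d)^'i \<Rightarrow> 'i \<Rightarrow> (real^'d) set" where
  "closed_cell x i = {w \<in> unit_cube. \<forall>k. norm (x$i - w) \<le> norm (x$k - w)}"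

text \<open>One Newton step in direction \<open>axis a 1\<close> for
  \<open>sqdist_diff x i k\<close>, whose slope there is \<open>2 * (x$i$a - x$k$a)\<close>. As the
  function is affine the step is exact and lands on the mediator.\<close>

definition mediator_proj :: "'d \<Rightarrow> (real^'d)^'i \<Rightarrow> 'i \<Rightarrow> 'i \<Rightarrow> real^'d \<Rightarrow> real^'d" where
  "mediator_proj a x i k v = v - (sqdist_diff x i k v / (2 * (x$i$a - x$k$a))) *\<^sub>R axis a 1"

lemma sqdist_diff_affine:
  "sqdist_diff x i k w = (2 *\<^sub>R (x$i - x$k)) \<bullet> w + ((norm (x$k))\<^sup>2 - (norm (x$i))\<^sup>2)"
  by (simp add: sqdist_diff_def power2_norm_eq_inner inner_diff_left inner_diff_right inner_commute algebra_simps)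

lemma sqdist_diff_shift:
  "sqdist_diff x i k (v + t *\<^sub>R axis a 1) = sqdist_diff x i k v + 2 * t * (x$i$a - x$k$a)"
  by (simp add: sqdist_diff_affine inner_add_right inner_axis algebra_simps)

lemma sqdist_diff_commute: "sqdist_diff x k i w = - sqdist_diff x i k w"
  by (simp add: sqdist_diff_def)

lemma mediator_proj_commute: "mediator_proj a x k i = mediator_proj a x i k"
proof
  fix v
  have "2 * (x$k$a - x$i$a) = - (2 * (x$i$a - x$k$a))" by simp
  then have "sqdist_diff x k i v / (2 * (x$k$a - x$i$a)) = sqdist_diff x i k v / (2 * (x$i$a - x$k$a))"
    by (simp only: sqdist_diff_commute[of x k i] minus_divide_left[symmetric] minus_divide_right[symmetric] minus_minus)
  then show "mediator_proj a x k i v = mediator_proj a x i k v"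
    by (simp only: mediator_proj_def)
qed

lemma sqdist_diff_mediator_proj:
  assumes "x$i$a \<noteq> x$k$a"
  shows "sqdist_diff x i l (mediator_proj a x i k v)
    = sqdist_diff x i l v - sqdist_diff x i k v * (x$i$a - x$l$a) / (x$i$a - x$k$a)"
  using assms
  sqdist_diff_shift[of x i l v "- (sqdist_diff x i k v / (2 * (x$i$a - x$k$a)))" a]
  by (simp add: mediator_proj_def field_simps)

lemma sqdist_diff_mediator_proj_self:
  assumes "x$i$a \<noteq> x$k$a"
  shows "sqdist_diff x i k (mediator_proj a x i k v) = 0"
  using assms by (simp add: sqdist_diff_mediator_proj)

lemma mediator_proj_fixed: "sqdist_diff x i k w = 0 \<Longrightarrow> mediator_proj a x i k w = w"
  by (simp add: mediator_proj_def)

lemma closed_cell_iff: "w \<in> closed_cell x i \<longleftrightarrow> w \<in> unit_cube \<and> (\<forall>k. 0 \<le> sqdist_diff x i k w)"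
  by (simp add: closed_cell_def sqdist_diff_def abs_le_square_iff[symmetric])

lemma continuous_on_mediator_proj: "continuous_on S (mediator_proj a x i k)"
  unfolding mediator_proj_def sqdist_diff_def divide_inverse by (intro continuous_intros)

lemma mediator_proj_measurable [measurable]: "mediator_proj a x i k \<in> borel_measurable borel"
  by (intro borel_measurable_continuous_onI continuous_on_mediator_proj)

lemma unit_cube_eq: "unit_cube = cbox 0 (\<chi> k. 1)"
  by (auto simp: unit_cube_def mem_box_cart)

lemma compact_unit_cube: "compact unit_cube" by (simp add: unit_cube_eq)

lemma unit_cube_measurable [measurable]: "unit_cube \<in> sets borel" by (simp add: unit_cube_eq)

lemma integrable_unit_cube_indicator: "integrable lborel (indicator unit_cube :: real^'d \<Rightarrow> real)"
  by (rule integrable_real_indicator)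
    (simp, rule emeasure_bounded_finite, rule compact_imp_bounded, rule compact_unit_cube)

lemma closed_closed_cell: "closed (closed_cell x i)"
  unfolding closed_cell_def
  by (intro closed_Collect_conj closed_Collect_all closed_Collect_le continuous_intros)
    (simp add: compact_imp_closed compact_unit_cube)

lemma closed_cell_measurable [measurable]: "closed_cell x i \<in> sets borel"
  by (intro borel_closed closed_closed_cell)

lemma closed_cell_subset: "closed_cell x i \<subseteq> unit_cube"
  by (auto simp: closed_cell_def)

lemma config_D_neq: "x \<in> config_D \<Longrightarrow> i \<noteq> k \<Longrightarrow> x$i$a \<noteq> x$k$a"
  by (auto simp: config_D_def)

lemma config_D_cube: "x \<in> config_D \<Longrightarrow> x$i \<in> unit_cube"
  by (auto simp: config_D_def)

lemma slab_axis: "slab (axis a 1) = {v :: real^'d. v$a \<in> {0..1}}"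
  by (auto simp: slab_def inner_axis inner_real_def)

text \<open>The weight is the reciprocal of
  \<open>\<bar>axis a 1 \<bullet> nvec x k i\<bar>\<close>. Its numerator later cancels the factor
  \<open>1 / norm (x$i - x$k)\<close> of the boundary terms.\<close>

lemma mediator_measure_eq:
  fixes x :: "(real^'d)^'i"
  assumes ne: "x$i$a \<noteq> x$k$a"
  shows "mediator_measure x k i =
    distr (density lborel (\<lambda>v. ennreal (indicator (slab (axis a 1)) v * (norm (x$i - x$k) / \<bar>x$i$a - x$k$a\<bar>))))
      lborel (mediator_proj a x i k)"
proof -
  let ?n = "nvec x k i" and ?p = "(1/2) *\<^sub>R (x$k + x$i)"
  have neq: "x$i \<noteq> x$k" using ne by auto
  have n: "?n \<bullet> ?n = 1"
    using neq by (simp add: nvec_def flip: power2_norm_eq_inner)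
  have en: "axis a 1 \<bullet> ?n = (x$i$a - x$k$a) / norm (x$i - x$k)"
    by (simp add: nvec_def inner_axis')
  have "(v - ?p) \<bullet> ?n / (axis a 1 \<bullet> ?n) = sqdist_diff x i k v / (2 * (x$i$a - x$k$a))" for v
  proof -
    have "(v - ?p) \<bullet> (x$i - x$k) = sqdist_diff x i k v / 2"
      by (simp add: sqdist_diff_affine power2_norm_eq_inner inner_diff_left inner_diff_right inner_add_left
          inner_commute algebra_simps)
    moreover have "(v - ?p) \<bullet> ?n = (v - ?p) \<bullet> (x$i - x$k) / norm (x$i - x$k)"
      by (simp add: nvec_def)
    ultimately have "(v - ?p) \<bullet> ?n = sqdist_diff x i k v / 2 / norm (x$i - x$k)" by (simp only:)
    then show ?thesis unfolding en using neq ne by simp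
  qed
  then have "(\<lambda>v. v - (((v - ?p) \<bullet> ?n) / (axis a 1 \<bullet> ?n)) *\<^sub>R axis a 1) = mediator_proj a x i k"
    by (simp add: mediator_proj_def fun_eq_iff)
  moreover have "indicator (slab (axis a 1)) v / \<bar>axis a 1 \<bullet> ?n\<bar>
      = indicator (slab (axis a 1)) v * (norm (x$i - x$k) / \<bar>x$i$a - x$k$a\<bar>)" for v :: "real^'d"
    by (simp add: en)
  moreover have "axis a 1 \<bullet> ?n \<noteq> 0" using ne neq by (simp add: en)
  ultimately show ?thesis
    using hyperplane_measure_oblique[OF n, of "axis a 1" ?p]
    by (simp add: mediator_measure_def inner_axis' )
qed

lemma mediator_integral:
  fixes x :: "(real^'d)^'i" and \<phi> :: "real^'d \<Rightarrow> 'b::{banach, second_countable_topology}"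
  assumes "x$i$a \<noteq> x$k$a" and [measurable]: "\<phi> \<in> borel_measurable borel"
  shows "(\<integral>w. \<phi> w \<partial>mediator_measure x k i) =
    (norm (x$i - x$k) / \<bar>x$i$a - x$k$a\<bar>) *\<^sub>R
      (\<integral>v. indicator (slab (axis a 1)) v *\<^sub>R \<phi> (mediator_proj a x i k v) \<partial>lborel)"
  unfolding mediator_measure_eq[OF assms(1)]
  by (subst integral_distr, simp, simp, subst integral_density)
    (auto simp: indicator_def simp flip: integral_scaleR_right intro!: Bochner_Integration.integral_cong)

text \<open>Exchanging the sites reverses the normal and puts the defining prism on the other side
  of the mediator, so the definition does not show the symmetry; the oblique form does.\<close>

lemma mediator_measure_commute:
  assumes "x$i$a \<noteq> x$k$a" shows "mediator_measure x k i = mediator_measure x i k"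
  using assms
  by (simp add: mediator_measure_eq[of x i a k] mediator_measure_eq[of x k a i] mediator_proj_commute[of a x k i]
      norm_minus_commute abs_minus_commute)

text \<open>The midpoint of the two sites is fixed by the projection. Its coordinates are strictly
  between 0 and 1, being means of two distinct numbers in [0,1], so the affine function in question
  is nonzero there.\<close>

lemma AE_mediator_proj_coord:
  fixes x :: "(real^'d)^'i"
  assumes x: "x \<in> config_D" and ik: "i \<noteq> k" and c: "c \<in> {0, 1}"
  shows "AE v in lborel. mediator_proj a x i k v $ b \<noteq> c"
proof -
  let ?s = "x$i$a - x$k$a" and ?p = "(1/2) *\<^sub>R (x$i + x$k)"
  have ne: "?s \<noteq> 0" using config_D_neq[OF x ik] by simp
  have "sqdist_diff x i k ?p = 0"
    by (simp add: sqdist_diff_affine power2_norm_eq_inner inner_diff_left inner_diff_right inner_add_left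
        inner_add_right inner_commute algebra_simps)
  then have p: "mediator_proj a x i k ?p = ?p" by (rule mediator_proj_fixed)
  have "0 \<le> x$i$b" "x$i$b \<le> 1" "0 \<le> x$k$b" "x$k$b \<le> 1" "x$i$b \<noteq> x$k$b"
    using config_D_cube[OF x] config_D_neq[OF x ik] by (auto simp: unit_cube_def)
  then have "?p $ b \<noteq> c" using c by auto
  then have 1: "mediator_proj a x i k ?p $ b - c \<noteq> 0" by (simp add: p)
  have 2: "mediator_proj a x i k v $ b - c
     = (axis b 1 - (axis a 1 $ b / (2 * ?s)) *\<^sub>R (2 *\<^sub>R (x$i - x$k))) \<bullet> v
       + (- (axis a 1 $ b / (2 * ?s)) * ((norm (x$k))\<^sup>2 - (norm (x$i))\<^sup>2) - c)" for v
  proof -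
    have 1: "(axis b 1 - q *\<^sub>R w) \<bullet> v = v $ b - q * (w \<bullet> v)" for q w
      by (simp add: inner_diff_left inner_axis')
    have 2: "y - (D + e) / t * m - c = (y - m / t * D) + (- (m / t) * e - c)" for y D e t m c :: real
      by (simp add: add_divide_distrib algebra_simps)
    show ?thesis
      unfolding mediator_proj_def sqdist_diff_affine
      by (simp only: vector_minus_component vector_scaleR_component 1 2 real_scaleR_def)
  qed
  have "AE v in lborel. mediator_proj a x i k v $ b - c \<noteq> 0"
    by (rule AE_affine_nonzero[OF 2 1])
  then show ?thesis by simp
qed

text \<open>If the mediators of $(x_i,x_k)$ and $(x_i,x_l)$ coincided, then $x_k$ and $x_l$ would both be the
  reflection of $x_i$.\<close>

lemma AE_mediator_proj_sqdist:
  fixes x :: "(real^'d)^'i"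
  assumes x: "x \<in> config_D" and ik: "i \<noteq> k" and il: "i \<noteq> l" and kl: "k \<noteq> l"
  shows "AE v in lborel. sqdist_diff x i l (mediator_proj a x i k v) \<noteq> 0"
proof -
  let ?s = "x$i$a - x$k$a" and ?r = "x$i$a - x$l$a" and ?p = "(1/2) *\<^sub>R (x$i + x$k)"
  have ne: "?s \<noteq> 0" using config_D_neq[OF x ik] by simp
  have neq: "x$i \<noteq> x$k" "x$i \<noteq> x$l" "x$k \<noteq> x$l"
    using config_D_neq[OF x ik, of a] config_D_neq[OF x il, of a] config_D_neq[OF x kl, of a] by auto
  have med: "sqdist_diff x i k (?p + u) = 2 * ((x$i - x$k) \<bullet> u)" for u
    by (simp add: sqdist_diff_affine power2_norm_eq_inner inner_diff_left inner_diff_right inner_add_left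
        inner_add_right inner_commute algebra_simps)
  have "\<exists>w. sqdist_diff x i k w = 0 \<and> sqdist_diff x i l w \<noteq> 0"
  proof (rule ccontr)
    assume "\<not> ?thesis"
    then have all: "sqdist_diff x i l w = 0" if "sqdist_diff x i k w = 0" for w using that by blast
    \<comment> \<open>\<open>u\<close> is the part of \<open>x$l - x$i\<close> orthogonal to
      \<open>x$k - x$i\<close>. Hence \<open>?p + u\<close> lies on the first mediator, and its
      lying on the second one forces \<open>u\<close> to be orthogonal to itself.\<close>
    define c where "c = ((x$l - x$i) \<bullet> (x$k - x$i)) / ((x$k - x$i) \<bullet> (x$k - x$i))"
    define u where "u = (x$l - x$i) - c *\<^sub>R (x$k - x$i)"
    have "(x$k - x$i) \<bullet> (x$k - x$i) \<noteq> 0" using neq by simp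
    then have "(x$k - x$i) \<bullet> u = 0"
      by (simp add: u_def inner_diff_right[of "x$k - x$i" "x$l - x$i"] c_def inner_commute)
    then have u0: "(x$i - x$k) \<bullet> u = 0" by (simp add: inner_diff_left)
    have p0: "sqdist_diff x i l ?p = 0" using all[of ?p] med[of 0] by simp
    have "sqdist_diff x i l (?p + u) = 0" using all[of "?p + u"] med[of u] u0 by simp
    then have "(x$i - x$l) \<bullet> u = 0" using p0 by (simp add: sqdist_diff_affine inner_add_right)
    then have "u \<bullet> u = 0"
      using u0 by (simp add: u_def[THEN arg_cong[where f="\<lambda>z. z \<bullet> u"]] inner_diff_left)
    then have xl: "x$l = x$i + c *\<^sub>R (x$k - x$i)" by (simp add: u_def diff_eq_eq add.commute)
    have "?p = x$i + (1/2) *\<^sub>R (x$k - x$i)" by (simp add: vec_eq_iff field_simps)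
    with xl have "x$l - ?p = (c - 1/2) *\<^sub>R (x$k - x$i)" "x$i - ?p = (- 1/2) *\<^sub>R (x$k - x$i)"
      by (simp_all add: scaleR_diff_left)
    \<comment> \<open>In units of \<open>x$k - x$i\<close> the midpoint sits at 1/2, and this is
      \<open>(c - 1/2)^2 - (1/2)^2\<close>; the roots put \<open>x$l\<close> on \<open>x$i\<close>
      or on \<open>x$k\<close>.\<close>
    then have "sqdist_diff x i l ?p = (c * (c - 1)) * ((x$k - x$i) \<bullet> (x$k - x$i))"
      unfolding sqdist_diff_def by (simp add: power_mult_distrib flip: power2_norm_eq_inner)
        (simp add: power2_eq_square algebra_simps)
    then have "c = 0 \<or> c = 1" using p0 neq by simp
    then show False using xl neq by auto
  qed
  then obtain p where p: "sqdist_diff x i k p = 0" "sqdist_diff x i l p \<noteq> 0" by blast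
  have "sqdist_diff x i l (mediator_proj a x i k v)
     = (2 *\<^sub>R (x$i - x$l) - (?r / ?s) *\<^sub>R (2 *\<^sub>R (x$i - x$k))) \<bullet> v
       + (((norm (x$l))\<^sup>2 - (norm (x$i))\<^sup>2) - (?r / ?s) * ((norm (x$k))\<^sup>2 - (norm (x$i))\<^sup>2))" for v
  proof -
    have 1: "(w' - q *\<^sub>R w) \<bullet> v = w' \<bullet> v - q * (w \<bullet> v)" for q w w'
      by (simp add: inner_diff_left)
    have 2: "(L + l) - (D + e) * r / s = (L - r / s * D) + (l - r / s * e)" for L l D e r s :: real
      by (simp add: add_divide_distrib algebra_simps)
    show ?thesis
      unfolding sqdist_diff_mediator_proj[where a=a, OF config_D_neq[OF x ik]]
      unfolding sqdist_diff_affine 1 2 ..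
  qed
  note affine = this
  have "sqdist_diff x i l (mediator_proj a x i k p) \<noteq> 0"
    using p by (simp add: mediator_proj_fixed)
  then show ?thesis by (rule AE_affine_nonzero[OF affine])
qed

section \<open>Uniform bounds on the cube, and lines parallel to an axis\<close>

lemma unit_cube_bound:
  obtains B where "B \<ge> 0" "\<And>w. w \<in> unit_cube \<Longrightarrow> norm (w :: real^'d) \<le> B"
proof -
  obtain B where "\<forall>w\<in>(unit_cube :: (real^'d) set). norm w \<le> B"
    using compact_imp_bounded[OF compact_unit_cube] unfolding bounded_iff by blast
  then show ?thesis by (intro that[of "\<bar>B\<bar>"]) force+
qed

lemma continuous_bound_unit_cube:
  fixes g :: "real^'d \<Rightarrow> 'b::real_normed_vector"
  assumes "continuous_on UNIV g"
  obtains C where "C \<ge> 0" "\<And>w. w \<in> unit_cube \<Longrightarrow> norm (g w) \<le> C"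
proof -
  have "compact (g ` unit_cube)"
    by (intro compact_continuous_image compact_unit_cube continuous_on_subset[OF assms]) auto
  from compact_imp_bounded[OF this] obtain C where "\<forall>w\<in>unit_cube. norm (g w) \<le> C"
    by (auto simp: bounded_iff)
  then show ?thesis by (intro that[of "\<bar>C\<bar>"]) force+
qed

lemma line_in_unit_cube:
  assumes "v \<in> unit_cube"
  shows "v + (t - v$a) *\<^sub>R axis a 1 \<in> unit_cube \<longleftrightarrow> t \<in> {0..1}"
proof -
  have "(v + (t - v$a) *\<^sub>R axis a 1) $ b = (if b = a then t else v$b)" for b
    by (simp add: axis_def)
  then show ?thesis using assms by (auto simp: unit_cube_def)
qed

text \<open>The slab controls the coordinate \<open>a\<close>, and motion along the axis leaves the
  others unchanged. Integrals over the unbounded slab are thereby supported in the cube, whose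
  indicator serves as dominating function.\<close>

lemma slab_line_in_unit_cube:
  assumes "v \<in> slab (axis a 1)" "v + t *\<^sub>R axis a 1 \<in> unit_cube"
  shows "v \<in> unit_cube"
proof -
  have "v $ b \<in> {0..1}" for b
  proof (cases "b = a")
    case True then show ?thesis using assms(1) by (simp add: slab_axis)
  next
    case False
    then have "(v + t *\<^sub>R axis a 1) $ b = v $ b" by (simp add: axis_def)
    then show ?thesis using assms(2) unfolding unit_cube_def by (metis (mono_tags, lifting) atLeastAtMost_iff mem_Collect_eq)
  qed
  then show ?thesis by (auto simp: unit_cube_def)
qed

lemma slab_mediator_proj_in_unit_cube:
  "v \<in> slab (axis a 1) \<Longrightarrow> mediator_proj a x i k v \<in> unit_cube \<Longrightarrow> v \<in> unit_cube"
  using slab_line_in_unit_cube[of v a "- (sqdist_diff x i k v / (2 * (x$i$a - x$k$a)))"]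
  by (simp add: mediator_proj_def)

lemma unit_cube_subset_slab: "unit_cube \<subseteq> slab (axis a 1)"
  by (auto simp: slab_axis unit_cube_def)

lemma mediator_proj_line:
  "mediator_proj a x i k v = v + (mediator_proj a x i k v $ a - v $ a) *\<^sub>R axis a 1"
  by (simp add: mediator_proj_def)

text \<open>The parameter \<open>t\<close> is the coordinate \<open>a\<close> of the point on the
  line, so the cube becomes [0,1] on every line. In this parameter \<open>sqdist_diff y i k\<close>
  is twice \<open>(y$i$a - y$k$a) * (t - mediator_proj a y i k v $ a)\<close>, which explains the
  choice of sign and endpoint.\<close>

lemma closed_cell_line:
  assumes v: "v \<in> unit_cube" and ne: "\<And>k. k \<noteq> i \<Longrightarrow> y$i$a \<noteq> y$k$a"
  shows "indicator (closed_cell y i) (v + (t - v$a) *\<^sub>R axis a 1) =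
    (indicator {0..1} t * (\<Prod>k\<in>-{i}. half_line (y$i$a - y$k$a) (mediator_proj a y i k v $ a) t) :: real)"
proof -
  let ?w = "v + (t - v$a) *\<^sub>R axis a 1"
  have half: "half_line (y$i$a - y$k$a) (mediator_proj a y i k v $ a) t = of_bool (0 \<le> sqdist_diff y i k ?w)"
    if "k \<noteq> i" for k
  proof -
    have "(y$i$a - y$k$a) * (t - mediator_proj a y i k v $ a) = sqdist_diff y i k ?w / 2"
      unfolding sqdist_diff_shift using ne[OF that] by (simp add: mediator_proj_def field_simps)
    then show ?thesis by (simp add: half_line_def)
  qed
  have "(\<Prod>k\<in>-{i}. half_line (y$i$a - y$k$a) (mediator_proj a y i k v $ a) t)
      = (\<Prod>k\<in>-{i}. of_bool (0 \<le> sqdist_diff y i k ?w))"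
    using half by (intro prod.cong) auto
  also have "\<dots> = of_bool (\<forall>k. 0 \<le> sqdist_diff y i k ?w)"
  proof -
    have "sqdist_diff y i i ?w = 0" by (simp add: sqdist_diff_def)
    then have "(\<forall>k. 0 \<le> sqdist_diff y i k ?w) \<longleftrightarrow> (\<forall>k\<in>-{i}. 0 \<le> sqdist_diff y i k ?w)" by force
    then show ?thesis by (auto intro!: prod.neutral)
  qed
  finally show ?thesis
    unfolding indicator_def closed_cell_iff line_in_unit_cube[OF v] by auto
qed

lemma closed_cell_sqdist_zero:
  "sqdist_diff x i k w = 0 \<Longrightarrow> w \<in> closed_cell x i \<longleftrightarrow> w \<in> closed_cell x k"
  by (simp add: sqdist_diff_def closed_cell_def)

text \<open>The projection is a quotient whose denominator could approach zero on
  \<open>config_D\<close>. The third premise keeps it above half its value at \<open>x\<close>, so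
  that \<open>L\<close> can be chosen independently of \<open>v\<close>.\<close>

lemma mediator_proj_lipschitz:
  fixes x :: "(real^'d)^'i"
  assumes x: "x \<in> config_D" and ik: "i \<noteq> k"
  obtains L where "L \<ge> 0" "\<And>y v. y \<in> config_D \<Longrightarrow> v \<in> unit_cube \<Longrightarrow>
    \<bar>(y$i$a - y$k$a) - (x$i$a - x$k$a)\<bar> < \<bar>x$i$a - x$k$a\<bar> / 2 \<Longrightarrow>
    \<bar>mediator_proj a y i k v $ a - mediator_proj a x i k v $ a\<bar> \<le> L * norm (y - x)"
proof -
  obtain B where B: "B \<ge> 0" "\<And>w. w \<in> unit_cube \<Longrightarrow> norm (w :: real^'d) \<le> B"
    using unit_cube_bound by metis
  define r where "r = \<bar>x$i$a - x$k$a\<bar>"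
  have r: "r > 0" using config_D_neq[OF x ik] by (simp add: r_def)
  have dist_le: "norm (z - v) \<le> 2 * B" if "z \<in> unit_cube" "v \<in> unit_cube" for z v :: "real^'d"
    using norm_triangle_ineq4[of z v] B(2)[OF that(1)] B(2)[OF that(2)] by simp
  show ?thesis
  \<comment> \<open>The first summand comes from the numerator: two squared distances, each changing
    by at most \<open>4 * B * n\<close>. The second comes from the denominator, with
    \<open>4 * B^2\<close> bounding the old numerator and \<open>2 * n\<close> the change of slope;
    \<open>2 * \<bar>s\<bar>\<close> is at least \<open>r\<close>.\<close>
  proof (rule that[of "8 * B / r + 8 * B\<^sup>2 / r\<^sup>2"])
    show "0 \<le> 8 * B / r + 8 * B\<^sup>2 / r\<^sup>2" using B r by simp
    fix y :: "(real^'d)^'i" and v :: "real^'d"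
    assume y: "y \<in> config_D" and v: "v \<in> unit_cube"
      and near: "\<bar>(y$i$a - y$k$a) - (x$i$a - x$k$a)\<bar> < \<bar>x$i$a - x$k$a\<bar> / 2"
    define n where "n = norm (y - x)"
    define s where "s = y$i$a - y$k$a"
    define s0 where "s0 = x$i$a - x$k$a"
    define N where "N = sqdist_diff y i k v"
    define N0 where "N0 = sqdist_diff x i k v"
    have comp: "norm (y$j - x$j) \<le> n" for j
      unfolding n_def using Finite_Cartesian_Product.norm_nth_le[of "y - x" j] by simp
    have comp2: "\<bar>y$j$a - x$j$a\<bar> \<le> n" for j
      using order_trans[OF component_le_norm_cart[of "y$j - x$j" a] comp[of j]] by simp
    have s_ge: "\<bar>s\<bar> \<ge> r / 2" using near abs_triangle_ineq2[of s0 s] by (simp add: r_def s_def s0_def abs_minus_commute)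
    then have s: "\<bar>s\<bar> \<ge> r / 2" "s \<noteq> 0" "s0 \<noteq> 0" "\<bar>s0\<bar> = r"
      using r by (auto simp: r_def s0_def)
    have ss: "\<bar>s0 - s\<bar> \<le> 2 * n" using comp2[of i] comp2[of k] unfolding s_def s0_def by linarith
    have sq: "\<bar>(norm (y$j - v))\<^sup>2 - (norm (x$j - v))\<^sup>2\<bar> \<le> 4 * B * n" for j
    proof -
      have "\<bar>(norm (y$j - v))\<^sup>2 - (norm (x$j - v))\<^sup>2\<bar>
          = \<bar>norm (y$j - v) + norm (x$j - v)\<bar> * \<bar>norm (y$j - v) - norm (x$j - v)\<bar>"
        by (simp add: power2_eq_square square_diff_square_factored abs_mult)
      also have "\<dots> \<le> (4 * B) * n"
      proof (rule mult_mono)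
        show "\<bar>norm (y$j - v) + norm (x$j - v)\<bar> \<le> 4 * B"
          using dist_le[OF config_D_cube[OF y, of j] v] dist_le[OF config_D_cube[OF x, of j] v] by simp
        show "\<bar>norm (y$j - v) - norm (x$j - v)\<bar> \<le> n"
          using norm_triangle_ineq3[of "y$j - v" "x$j - v"] comp[of j] by simp
      qed (use B in auto)
      finally show ?thesis .
    qed
    have N: "\<bar>N - N0\<bar> \<le> 8 * B * n"
      using sq[of i] sq[of k] unfolding N_def N0_def sqdist_diff_def by linarith
    have N0: "\<bar>N0\<bar> \<le> 4 * B\<^sup>2"
    proof -
      have "(norm (x$j - v))\<^sup>2 \<le> (2 * B)\<^sup>2" for j
        using dist_le[OF config_D_cube[OF x, of j] v] by (intro power_mono) auto
      then have "(norm (x$j - v))\<^sup>2 \<le> 4 * B\<^sup>2" for j by (simp add: power_mult_distrib)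
      from this[of i] this[of k] show ?thesis
        unfolding N0_def sqdist_diff_def
        using zero_le_power2[of "norm (x$i - v)"] zero_le_power2[of "norm (x$k - v)"] by linarith
    qed
    have "mediator_proj a y i k v $ a - mediator_proj a x i k v $ a = N0 / (2 * s0) - N / (2 * s)"
      by (simp add: mediator_proj_def N_def N0_def s_def s0_def)
    also have "\<dots> = - ((N - N0) / (2 * s)) - N0 * (s0 - s) / (2 * s * s0)"
      using s by (simp add: field_simps)
    finally have "\<bar>mediator_proj a y i k v $ a - mediator_proj a x i k v $ a\<bar>
        = \<bar>- ((N - N0) / (2 * s)) - N0 * (s0 - s) / (2 * s * s0)\<bar>" by (simp only:)
    also have "\<dots> \<le> \<bar>N - N0\<bar> / (2 * \<bar>s\<bar>) + \<bar>N0\<bar> * \<bar>s0 - s\<bar> / (2 * \<bar>s\<bar> * \<bar>s0\<bar>)"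
      by (rule order_trans[OF abs_triangle_ineq4]) (simp add: abs_mult)
    also have "\<dots> \<le> (8 * B * n) / r + (4 * B\<^sup>2) * (2 * n) / (r * r)"
      by (intro add_mono frac_le mult_mono N N0 ss) (use s r B in \<open>auto simp: n_def\<close>)
    also have "\<dots> = (8 * B / r + 8 * B\<^sup>2 / r\<^sup>2) * norm (y - x)"
      by (simp add: n_def power2_eq_square distrib_right)
    finally show "\<bar>mediator_proj a y i k v $ a - mediator_proj a x i k v $ a\<bar>
      \<le> (8 * B / r + 8 * B\<^sup>2 / r\<^sup>2) * norm (y - x)" .
  qed
qed

text \<open>This is what implicit differentiation of the mediator equation gives. Writing the result
  with the projected point in place of \<open>v\<close> absorbs the derivative of the denominator in
  the quotient rule and prepares the integrand on the facet.\<close>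

lemma mediator_proj_has_derivative:
  fixes x :: "(real^'d)^'i"
  assumes ne: "x$i$a \<noteq> x$k$a"
  shows "((\<lambda>y. mediator_proj a y i k v $ a) has_derivative
    (\<lambda>h. - (((x$k - mediator_proj a x i k v) \<bullet> h$k - (x$i - mediator_proj a x i k v) \<bullet> h$i) / (x$i$a - x$k$a)))) (at x within S)"
proof -
  have nth: "((\<lambda>y. y$j) has_derivative (\<lambda>h. h$j)) (at x within S)" for j
    by (rule bounded_linear.has_derivative[OF bounded_linear_vec_nth has_derivative_ident])
  have nth2: "((\<lambda>y. y$j$a) has_derivative (\<lambda>h. h$j$a)) (at x within S)" for j
    by (rule bounded_linear.has_derivative[OF bounded_linear_vec_nth nth])
  have eq: "(\<lambda>y :: (real^'d)^'i. mediator_proj a y i k v $ a)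
     = (\<lambda>y. v$a - (((y$k - v) \<bullet> (y$k - v)) - ((y$i - v) \<bullet> (y$i - v))) / (2 * (y$i$a - y$k$a)))"
    by (simp add: mediator_proj_def sqdist_diff_def power2_norm_eq_inner)
  define q where "q = sqdist_diff x i k v / (2 * (x$i$a - x$k$a))"
  have inner: "(x$j - mediator_proj a x i k v) \<bullet> u = (x$j - v) \<bullet> u + q * u$a" for j u
    by (simp add: mediator_proj_def q_def inner_diff_left inner_axis' algebra_simps)
  have q2: "((x$k - v) \<bullet> (x$k - v)) - ((x$i - v) \<bullet> (x$i - v)) = q * (2 * (x$i$a - x$k$a))"
    using ne by (simp add: q_def sqdist_diff_def power2_norm_eq_inner)
  have num: "((\<lambda>y. ((y$k - v) \<bullet> (y$k - v)) - ((y$i - v) \<bullet> (y$i - v))) has_derivative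
      (\<lambda>h. 2 * ((x$k - v) \<bullet> h$k) - 2 * ((x$i - v) \<bullet> h$i))) (at x within S)"
    by (rule derivative_eq_intros nth refl)+ (simp add: inner_commute fun_eq_iff)
  have den: "((\<lambda>y. 2 * (y$i$a - y$k$a)) has_derivative (\<lambda>h. 2 * (h$i$a - h$k$a))) (at x within S)"
    by (rule derivative_eq_intros nth2 refl)+ simp
  have ne3: "x$i$a - x$k$a \<noteq> 0" using ne by simp
  have ne2: "2 * (x$i$a - x$k$a) \<noteq> 0" using ne by simp
  have alg: "0 - ((2 * b - 2 * c) * (2 * s) - (q * (2 * s)) * (2 * (d - e))) / (2 * s * (2 * s))
      = - ((b + q * e - (c + q * d)) / s)" if "s \<noteq> 0" for b c d e s :: real
    using that by (simp add: field_simps)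
  have "((\<lambda>y. v$a - (((y$k - v) \<bullet> (y$k - v)) - ((y$i - v) \<bullet> (y$i - v))) / (2 * (y$i$a - y$k$a))) has_derivative
     (\<lambda>h. 0 - ((2 * ((x$k - v) \<bullet> h$k) - 2 * ((x$i - v) \<bullet> h$i)) * (2 * (x$i$a - x$k$a))
       - (((x$k - v) \<bullet> (x$k - v)) - ((x$i - v) \<bullet> (x$i - v))) * (2 * (h$i$a - h$k$a)))
       / (2 * (x$i$a - x$k$a) * (2 * (x$i$a - x$k$a))))) (at x within S)"
    by (intro has_derivative_diff has_derivative_const has_derivative_divide'[OF num den ne2])
  then show ?thesis
    unfolding eq inner q2 alg[OF ne3] .
qed

section \<open>The derivative of a cell integral\<close>

lemma mediator_integrand_integrable:
  fixes \<phi> :: "real^'d \<Rightarrow> 'b::euclidean_space"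
  assumes \<phi>: "continuous_on UNIV \<phi>" and A [measurable]: "A \<in> sets borel" and sub: "A \<subseteq> unit_cube"
  shows "integrable lborel (\<lambda>v. indicator (slab (axis a 1)) v *\<^sub>R (indicator A (mediator_proj a x i k v) *\<^sub>R \<phi> (mediator_proj a x i k v)))"
proof -
  obtain C where C: "C \<ge> 0" "\<And>w. w \<in> unit_cube \<Longrightarrow> norm (\<phi> w) \<le> C"
    using continuous_bound_unit_cube[OF \<phi>] by metis
  have [measurable]: "\<phi> \<in> borel_measurable borel" using \<phi> by (rule borel_measurable_continuous_onI)
  show ?thesis
  proof (rule Bochner_Integration.integrable_bound)
    show "integrable lborel (\<lambda>v :: real^'d. C * indicator unit_cube v)" by (simp add: integrable_unit_cube_indicator)
    have "norm (indicator (slab (axis a 1)) v *\<^sub>R (indicator A (mediator_proj a x i k v) *\<^sub>R \<phi> (mediator_proj a x i k v)))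
        \<le> C * indicator unit_cube v" for v
      using C sub slab_mediator_proj_in_unit_cube[of v a x i k] by (auto simp: indicator_def)
    then show "AE v in lborel. norm (indicator (slab (axis a 1)) v *\<^sub>R (indicator A (mediator_proj a x i k v) *\<^sub>R \<phi> (mediator_proj a x i k v)))
        \<le> norm (C * indicator unit_cube v)"
      by (auto intro!: AE_I2 order_trans[OF _ abs_ge_self])
  qed measurable
qed

lemma cell_line_integral:
  fixes g :: "real^'d \<Rightarrow> 'b::euclidean_space"
  assumes ne: "\<And>k. k \<noteq> i \<Longrightarrow> y$i$a \<noteq> y$k$a"
  shows "(\<integral>t. indicator (slab (axis a 1)) v *\<^sub>R
        (indicator (closed_cell y i) (v + t *\<^sub>R axis a 1) *\<^sub>R g (v + t *\<^sub>R axis a 1)) \<partial>lborel)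
    = indicator unit_cube v *\<^sub>R (\<integral>t. (indicator {0..1} t *
        (\<Prod>k\<in>-{i}. half_line (y$i$a - y$k$a) (mediator_proj a y i k v $ a) t)) *\<^sub>R g (v + (t - v$a) *\<^sub>R axis a 1) \<partial>lborel)"
proof (cases "v \<in> unit_cube")
  case True
  then have "v \<in> slab (axis a 1)" using unit_cube_subset_slab by blast
  then have "(\<integral>t. indicator (slab (axis a 1)) v *\<^sub>R
        (indicator (closed_cell y i) (v + t *\<^sub>R axis a 1) *\<^sub>R g (v + t *\<^sub>R axis a 1)) \<partial>lborel)
    = (\<integral>t. indicator (closed_cell y i) (v + t *\<^sub>R axis a 1) *\<^sub>R g (v + t *\<^sub>R axis a 1) \<partial>lborel)"
    by simp
  also have "\<dots> = \<bar>1\<bar> *\<^sub>R (\<integral>t. indicator (closed_cell y i) (v + (- v$a + 1 * t) *\<^sub>R axis a 1) *\<^sub>R g (v + (- v$a + 1 * t) *\<^sub>R axis a 1) \<partial>lborel)"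
    by (rule lborel_integral_real_affine) simp
  also have "\<dots> = (\<integral>t. indicator (closed_cell y i) (v + (t - v$a) *\<^sub>R axis a 1) *\<^sub>R g (v + (t - v$a) *\<^sub>R axis a 1) \<partial>lborel)"
    by (simp add: add.commute[of "- v$a"])
  finally show ?thesis
    using True by (simp add: closed_cell_line[OF True ne])
next
  case False
  have "indicator (slab (axis a 1)) v *\<^sub>R
        (indicator (closed_cell y i) (v + t *\<^sub>R axis a 1) *\<^sub>R g (v + t *\<^sub>R axis a 1)) = 0" for t
    using False slab_line_in_unit_cube[of v a t] closed_cell_subset[of y i] by (auto simp: indicator_def)
  then show ?thesis using False by (simp only: Bochner_Integration.integral_zero) simp
qed

text \<open>A point equidistant from both sites lies in both cells or in neither. The factor
  \<open>k\<close> may be dropped since a closed half line contains its own endpoint; what remains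
  is the cofactor of \<open>interval_integral_deriv\<close>.\<close>

lemma mediator_cell_indicator:
  assumes v: "v \<in> unit_cube" and ne: "\<And>k. k \<noteq> i \<Longrightarrow> x$i$a \<noteq> x$k$a" and k: "k \<noteq> i"
  shows "indicator (closed_cell x i \<inter> closed_cell x k) (mediator_proj a x i k v) =
    (indicator {0..1} (mediator_proj a x i k v $ a) * (\<Prod>l\<in>-{i}-{k}. half_line (x$i$a - x$l$a)
       (mediator_proj a x i l v $ a) (mediator_proj a x i k v $ a)) :: real)"
proof -
  let ?Q = "mediator_proj a x i k v"
  have "?Q \<in> closed_cell x i \<longleftrightarrow> ?Q \<in> closed_cell x k"
    by (intro closed_cell_sqdist_zero sqdist_diff_mediator_proj_self ne k)
  then have "indicator (closed_cell x i \<inter> closed_cell x k) ?Q = (indicator (closed_cell x i) ?Q :: real)"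
    by (simp add: indicator_def)
  also have "\<dots> = indicator {0..1} (?Q $ a) * (\<Prod>l\<in>-{i}. half_line (x$i$a - x$l$a) (mediator_proj a x i l v $ a) (?Q $ a))"
    using closed_cell_line[OF v ne, where t="?Q $ a"] mediator_proj_line[of a x i k v] by simp
  also have "(\<Prod>l\<in>-{i}. half_line (x$i$a - x$l$a) (mediator_proj a x i l v $ a) (?Q $ a))
     = (\<Prod>l\<in>-{i}-{k}. half_line (x$i$a - x$l$a) (mediator_proj a x i l v $ a) (?Q $ a))"
    using k by (subst prod.remove[of _ k]) (auto simp: half_line_def)
  finally show ?thesis .
qed

lemma AE_mediator_proj_generic:
  fixes x :: "(real^'d)^'i"
  assumes x: "x \<in> config_D"
  shows "AE v in lborel. (\<forall>k\<in>-{i}. \<forall>b. mediator_proj a x i k v $ b \<noteq> 0 \<and> mediator_proj a x i k v $ b \<noteq> 1) \<and>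
    (\<forall>k\<in>-{i}. \<forall>l\<in>-{i}-{k}. sqdist_diff x i l (mediator_proj a x i k v) \<noteq> 0)"
  by (intro AE_conjI AE_finite_allI AE_ball_countable[THEN iffD2] ballI countable_finite)
    (auto intro!: AE_mediator_proj_coord[OF x] AE_mediator_proj_sqdist[OF x] simp: AE_all_countable)

text \<open>A Reynolds transport formula: the weight multiplying \<open>g w\<close> is the outward
  normal speed of the mediator at \<open>w\<close> when the sites move with velocity
  \<open>h\<close>.\<close>

lemma cell_integral_deriv:
  fixes x :: "(real^'d)^'i::finite" and g :: "real^'d \<Rightarrow> 'b::euclidean_space"
  assumes x: "x \<in> config_D" and g: "continuous_on UNIV g"
  shows "((\<lambda>y. \<integral>w. indicator (closed_cell y i) w *\<^sub>R g w \<partial>lborel) has_derivative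
    (\<lambda>h. \<Sum>k\<in>-{i}. LINT w:(closed_cell x i \<inter> closed_cell x k)|mediator_measure x k i.
       (((x$k - w) \<bullet> h$k - (x$i - w) \<bullet> h$i) / norm (x$i - x$k)) *\<^sub>R g w)) (at x within config_D)"
    (is "(?G has_derivative ?D) _")
proof -
  \<comment> \<open>Any axis will do, since \<open>config_D\<close> separates the sites in every
    coordinate.\<close>
  define a where "a = (undefined :: 'd)"
  let ?e = "axis a 1 :: real^'d"
  let ?s = "\<lambda>y :: (real^'d)^'i. \<lambda>k. y$i$a - y$k$a"
  let ?Q = "\<lambda>y k v. mediator_proj a y i k v"
  let ?line = "\<lambda>v t. v + (t - v$a) *\<^sub>R ?e"
  let ?A = "\<lambda>k. closed_cell x i \<inter> closed_cell x k"
  let ?\<phi> = "\<lambda>k h w. (((x$k - w) \<bullet> h$k - (x$i - w) \<bullet> h$i) / \<bar>?s x k\<bar>) *\<^sub>R g w"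
  have [measurable]: "g \<in> borel_measurable borel" using g by (rule borel_measurable_continuous_onI)
  have ne: "?s y k \<noteq> 0" "y$i$a \<noteq> y$k$a" if "y \<in> config_D" "k \<noteq> i" for y k
    using config_D_neq[OF that(1), of i k a] that(2) by auto
  \<comment> \<open>On this open neighbourhood the slopes keep their signs and stay away from zero;
    passing to \<open>S\<close> does not change the filter.\<close>
  define U where "U = {y :: (real^'d)^'i. \<forall>k\<in>-{i}. \<bar>?s y k - ?s x k\<bar> < \<bar>?s x k\<bar> / 2}"
  define S where "S = config_D \<inter> U"
  have "open U"
  proof -
    have "U = (\<Inter>k\<in>-{i}. {y. \<bar>?s y k - ?s x k\<bar> < \<bar>?s x k\<bar> / 2})" by (auto simp: U_def)
    then show ?thesis by (auto intro!: open_INT open_Collect_less continuous_intros)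
  qed
  moreover have xU: "x \<in> U" using ne[OF x] by (auto simp: U_def)
  ultimately have at: "at x within config_D = at x within S"
    by (intro at_within_nhd[of x U]) (auto simp: S_def)
  have xS: "x \<in> S" using x xU by (simp add: S_def)
  \<comment> \<open>The orientations are those at \<open>x\<close>, not at \<open>y\<close>: the
    one-dimensional lemmas need them fixed, and on \<open>S\<close> they agree.\<close>
  define J where "J y v = indicator unit_cube v *\<^sub>R (\<integral>t. (indicator {0..1} t *
        (\<Prod>k\<in>-{i}. half_line (?s x k) (?Q y k v $ a) t)) *\<^sub>R g (?line v t) \<partial>lborel)" for y v
  define D where "D v h = (\<Sum>k\<in>-{i}. indicator (slab ?e) v *\<^sub>R (indicator (?A k) (?Q x k v) *\<^sub>R ?\<phi> k h (?Q x k v)))" for v h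
  have e: "?e \<bullet> ?e = 1" by (simp add: inner_axis')
  have int: "integrable lborel (\<lambda>w. indicator (closed_cell y i) w *\<^sub>R g w)" for y :: "(real^'d)^'i"
    by (rule integrable_continuous_bounded[OF g _ closed_cell_subset compact_unit_cube]) simp
  have J_eq: "J y = (\<lambda>v. \<integral>t. indicator (slab ?e) v *\<^sub>R
        (indicator (closed_cell y i) (v + t *\<^sub>R ?e) *\<^sub>R g (v + t *\<^sub>R ?e)) \<partial>lborel)" if y: "y \<in> S" for y
  proof -
    have yc: "y \<in> config_D" using y by (simp add: S_def)
    have "half_line (?s x k) \<tau> t = half_line (?s y k) \<tau> t" if k: "k \<in> -{i}" for k \<tau> t
    proof -
      have "\<bar>?s y k - ?s x k\<bar> < \<bar>?s x k\<bar> / 2" using y k by (auto simp: S_def U_def)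
      then have "?s y k > 0 \<longleftrightarrow> ?s x k > 0" "?s y k < 0 \<longleftrightarrow> ?s x k < 0"
        by (auto simp: abs_if split: if_splits)
      then show ?thesis by (auto simp: half_line_def zero_le_mult_iff)
    qed
    moreover have "(\<integral>t. indicator (slab ?e) v *\<^sub>R
        (indicator (closed_cell y i) (v + t *\<^sub>R ?e) *\<^sub>R g (v + t *\<^sub>R ?e)) \<partial>lborel)
      = indicator unit_cube v *\<^sub>R (\<integral>t. (indicator {0..1} t *
        (\<Prod>k\<in>-{i}. half_line (?s y k) (?Q y k v $ a) t)) *\<^sub>R g (?line v t) \<partial>lborel)" for v
      by (rule cell_line_integral) (rule ne(2)[OF yc])
    ultimately show ?thesis unfolding J_def by simp
  qed
  have G_eq: "?G y = (\<integral>v. J y v \<partial>lborel)" if "y \<in> S" for y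
    unfolding J_eq[OF that] by (rule integral_oblique[OF int e])
  obtain C where C: "C \<ge> 0" "\<And>w. w \<in> unit_cube \<Longrightarrow> norm (g w) \<le> C"
    using continuous_bound_unit_cube[OF g] by metis
  have gline: "continuous_on UNIV (\<lambda>t. g (?line v t))" for v
    by (rule continuous_on_compose2[OF g]) (auto intro!: continuous_intros)
  have "\<exists>L. \<forall>k\<in>-{i}. \<forall>y v. y \<in> S \<longrightarrow> v \<in> unit_cube \<longrightarrow> \<bar>?Q y k v $ a - ?Q x k v $ a\<bar> \<le> L k * norm (y - x)"
  proof (rule bchoice, rule ballI)
    fix k assume k: "k \<in> -{i}"
    then have "i \<noteq> k" by auto
    from mediator_proj_lipschitz[OF x this, of a] obtain L where
      "\<And>y v. y \<in> config_D \<Longrightarrow> v \<in> unit_cube \<Longrightarrow> \<bar>?s y k - ?s x k\<bar> < \<bar>?s x k\<bar> / 2 \<Longrightarrow>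
        \<bar>?Q y k v $ a - ?Q x k v $ a\<bar> \<le> L * norm (y - x)" by metis
    then show "\<exists>L. \<forall>y v. y \<in> S \<longrightarrow> v \<in> unit_cube \<longrightarrow> \<bar>?Q y k v $ a - ?Q x k v $ a\<bar> \<le> L * norm (y - x)"
      using k by (auto simp: S_def U_def)
  qed
  then obtain L where L: "\<And>k y v. k \<in> -{i} \<Longrightarrow> y \<in> S \<Longrightarrow> v \<in> unit_cube \<Longrightarrow>
      \<bar>?Q y k v $ a - ?Q x k v $ a\<bar> \<le> L k * norm (y - x)" by metis
  have "((\<lambda>y. \<integral>v. J y v \<partial>lborel) has_derivative (\<lambda>h. \<integral>v. D v h \<partial>lborel)) (at x within S)"
  proof (rule has_derivative_integral_dominated[OF _ _ xS])
    show "AE v in lborel. ((\<lambda>y. J y v) has_derivative D v) (at x within S)"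
      using AE_mediator_proj_generic[OF x, of i a]
    proof eventually_elim
      case (elim v)
      show ?case
      proof (cases "v \<in> unit_cube")
        case True
        have dist: "?Q x k v $ a \<noteq> ?Q x l v $ a" if "k \<in> -{i}" "l \<in> -{i}" "k \<noteq> l" for k l
        proof
          assume "?Q x k v $ a = ?Q x l v $ a"
          then have "?Q x k v = ?Q x l v"
            by (metis mediator_proj_line)
          moreover have "sqdist_diff x i l (?Q x l v) = 0"
            using that ne(2)[OF x] by (intro sqdist_diff_mediator_proj_self) auto
          moreover have "sqdist_diff x i l (?Q x k v) \<noteq> 0" using elim that by auto
          ultimately show False by simp
        qed
        have "((\<lambda>y. \<integral>t. (indicator {0..1} t * (\<Prod>k\<in>-{i}. half_line (?s x k) (?Q y k v $ a) t)) *\<^sub>R g (?line v t) \<partial>lborel)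
          has_derivative (\<lambda>h. \<Sum>k\<in>-{i}. (indicator {0..1} (?Q x k v $ a) *
             (\<Prod>l\<in>-{i} - {k}. half_line (?s x l) (?Q x l v $ a) (?Q x k v $ a)) *
             (- sgn (?s x k) * - (((x$k - ?Q x k v) \<bullet> h$k - (x$i - ?Q x k v) \<bullet> h$i) / ?s x k))) *\<^sub>R g (?line v (?Q x k v $ a))))
          (at x within S)"
          by (rule interval_integral_deriv[OF _ gline])
            (use elim dist ne[OF x] xS in \<open>auto intro!: mediator_proj_has_derivative\<close>)
        also have "(\<lambda>h. \<Sum>k\<in>-{i}. (indicator {0..1} (?Q x k v $ a) *
             (\<Prod>l\<in>-{i} - {k}. half_line (?s x l) (?Q x l v $ a) (?Q x k v $ a)) *
             (- sgn (?s x k) * - (((x$k - ?Q x k v) \<bullet> h$k - (x$i - ?Q x k v) \<bullet> h$i) / ?s x k))) *\<^sub>R g (?line v (?Q x k v $ a))) = D v"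
          unfolding D_def
        proof (intro ext sum.cong refl)
          fix h k assume "k \<in> -{i}"
          then have k: "k \<noteq> i" by auto
          \<comment> \<open>One minus sign is the orientation of the endpoint, the other its
            derivative; together they turn the slope into its absolute value.\<close>
          have sg: "- sgn s * - (c / s) = c / \<bar>s\<bar>" for c s :: real
            by (simp add: sgn_if)
          have ind: "indicator (?A k) (?Q x k v) = (indicator {0..1} (?Q x k v $ a) *
              (\<Prod>l\<in>-{i} - {k}. half_line (?s x l) (?Q x l v $ a) (?Q x k v $ a)) :: real)"
            by (rule mediator_cell_indicator[OF True _ k]) (rule ne(2)[OF x])
          have "v \<in> slab ?e" using True unit_cube_subset_slab by blast
          then show "(indicator {0..1} (?Q x k v $ a) *
             (\<Prod>l\<in>-{i} - {k}. half_line (?s x l) (?Q x l v $ a) (?Q x k v $ a)) *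
             (- sgn (?s x k) * - (((x$k - ?Q x k v) \<bullet> h$k - (x$i - ?Q x k v) \<bullet> h$i) / ?s x k))) *\<^sub>R g (?line v (?Q x k v $ a))
            = indicator (slab ?e) v *\<^sub>R (indicator (?A k) (?Q x k v) *\<^sub>R ?\<phi> k h (?Q x k v))"
            unfolding sg ind mediator_proj_line[symmetric] by simp
        qed
        finally show ?thesis using True by (simp add: J_def)
      next
        case False
        have "D v = (\<lambda>h. 0)"
          unfolding D_def using False slab_mediator_proj_in_unit_cube[of v a x i] closed_cell_subset[of x i]
          by (intro ext sum.neutral) (auto simp: indicator_def)
        then show ?thesis using False by (simp add: J_def)
      qed
    qed
    show "linear (D v)" for v
      unfolding D_def
      by (intro linear_compose_sum ballI linearI)
        (simp_all add: inner_add_right algebra_simps add_divide_distrib diff_divide_distrib)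
    show "integrable lborel (J y)" if "y \<in> S" for y
      unfolding J_eq[OF that] by (rule integrable_oblique[OF int e])
    show "integrable lborel (\<lambda>v. D v h)" for h
      unfolding D_def
      by (intro Bochner_Integration.integrable_sum mediator_integrand_integrable continuous_intros g)
        (use closed_cell_subset ne(2)[OF x] in auto)
    show "norm (J y v - J x v) \<le> (indicator unit_cube v * (C * sum L (-{i}))) * norm (y - x)" if y: "y \<in> S" for y v
    proof (cases "v \<in> unit_cube")
      case True
      have "norm (J y v - J x v) \<le> C * (\<Sum>k\<in>-{i}. \<bar>?Q y k v $ a - ?Q x k v $ a\<bar>)"
        using True unfolding J_def
        by (simp, intro interval_integral_lipschitz gline)
          (use C ne[OF x] line_in_unit_cube[OF True, of _ a] in auto)
      also have "\<dots> \<le> C * (\<Sum>k\<in>-{i}. L k * norm (y - x))"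
        by (intro mult_left_mono sum_mono L C y True)
      finally show ?thesis using True by (simp add: mult.assoc flip: sum_distrib_right)
    qed (simp add: J_def)
    show "integrable lborel (\<lambda>v :: real^'d. indicator unit_cube v * (C * sum L (-{i})))" by (simp add: integrable_unit_cube_indicator)
  qed
  also have "(\<lambda>h. \<integral>v. D v h \<partial>lborel) = ?D"
  proof
    fix h
    have "(\<integral>v. D v h \<partial>lborel) = (\<Sum>k\<in>-{i}. \<integral>v. indicator (slab ?e) v *\<^sub>R (indicator (?A k) (?Q x k v) *\<^sub>R ?\<phi> k h (?Q x k v)) \<partial>lborel)"
      unfolding D_def
      by (intro Bochner_Integration.integral_sum mediator_integrand_integrable continuous_intros g)
        (use closed_cell_subset ne(2)[OF x] in auto)
    also have "\<dots> = ?D h"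
    proof (intro sum.cong refl)
      fix k assume "k \<in> -{i}"
      then have k: "k \<noteq> i" by auto
      have nz: "norm (x$i - x$k) \<noteq> 0" using ne(2)[OF x k] by auto
      have "(LINT w:?A k|mediator_measure x k i. (((x$k - w) \<bullet> h$k - (x$i - w) \<bullet> h$i) / norm (x$i - x$k)) *\<^sub>R g w)
        = (norm (x$i - x$k) / \<bar>?s x k\<bar>) *\<^sub>R (\<integral>v. indicator (slab ?e) v *\<^sub>R (indicator (?A k) (?Q x k v) *\<^sub>R
             ((((x$k - ?Q x k v) \<bullet> h$k - (x$i - ?Q x k v) \<bullet> h$i) / norm (x$i - x$k)) *\<^sub>R g (?Q x k v))) \<partial>lborel)"
        unfolding set_lebesgue_integral_def by (rule mediator_integral[OF ne(2)[OF x k]]) measurable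
      also have "\<dots> = (\<integral>v. indicator (slab ?e) v *\<^sub>R (indicator (?A k) (?Q x k v) *\<^sub>R ?\<phi> k h (?Q x k v)) \<partial>lborel)"
        unfolding integral_scaleR_right[symmetric]
        using nz by (intro Bochner_Integration.integral_cong) (auto simp: indicator_def)
      finally show "(\<integral>v. indicator (slab ?e) v *\<^sub>R (indicator (?A k) (?Q x k v) *\<^sub>R ?\<phi> k h (?Q x k v)) \<partial>lborel)
        = (LINT w:?A k|mediator_measure x k i. (((x$k - w) \<bullet> h$k - (x$i - w) \<bullet> h$i) / norm (x$i - x$k)) *\<^sub>R g w)" ..
    qed
    finally show "(\<integral>v. D v h \<partial>lborel) = ?D h" .
  qed
  finally have "((\<lambda>y. \<integral>v. J y v \<partial>lborel) has_derivative ?D) (at x within S)" .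
  then have "(?G has_derivative ?D) (at x within S)"
    by (rule has_derivative_transform[OF xS, rotated]) (rule G_eq)
  then show ?thesis by (simp only: at)
qed

section \<open>Voronoi cells and facet integrals\<close>

lemma voronoi_cell_subset: "voronoi_cell \<iota> x i \<subseteq> unit_cube"
  by (auto simp: voronoi_cell_def)

lemma voronoi_cell_subset_closed: "voronoi_cell \<iota> x i \<subseteq> closed_cell x i"
proof
  fix w assume w: "w \<in> voronoi_cell \<iota> x i"
  have "norm (x$i - w) \<le> norm (x$k - w)" for k
    using w by (cases "k = i") (auto simp: voronoi_cell_def less_imp_le)
  then show "w \<in> closed_cell x i" using w by (auto simp: closed_cell_def voronoi_cell_def)
qed

lemma voronoi_cellI:
  assumes "w \<in> unit_cube" "\<And>k. k \<noteq> i \<Longrightarrow> 0 < sqdist_diff x i k w"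
  shows "w \<in> voronoi_cell \<iota> x i"
proof -
  have "norm (x$i - w) < norm (x$k - w)" if "k \<noteq> i" for k
    using assms(2)[OF that] by (auto simp: sqdist_diff_def dest: power_less_imp_less_base)
  then show ?thesis using assms(1) by (auto simp: voronoi_cell_def)
qed

lemma sqdist_diff_site_pos: "x$i \<noteq> x$k \<Longrightarrow> 0 < sqdist_diff x i k (x$i)"
  by (simp add: sqdist_diff_def)

text \<open>Moving towards the site makes every weak inequality of the closed cell strict.\<close>

lemma closure_voronoi_cell:
  assumes x: "x \<in> config_D"
  shows "closure (voronoi_cell \<iota> x i) = closed_cell x i"
proof
  show "closure (voronoi_cell \<iota> x i) \<subseteq> closed_cell x i"
    by (intro closure_minimal voronoi_cell_subset_closed closed_closed_cell)
  show "closed_cell x i \<subseteq> closure (voronoi_cell \<iota> x i)"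
  proof
    fix w assume w: "w \<in> closed_cell x i"
    define t where "t n = inverse (real (Suc n))" for n
    have t: "0 < t n" "t n \<le> 1" for n by (auto simp: t_def inverse_le_1_iff)
    let ?w = "\<lambda>n. (1 - t n) *\<^sub>R w + t n *\<^sub>R x$i"
    have conv: "convex (unit_cube :: (real^'a) set)" by (simp add: unit_cube_eq)
    have "?w n \<in> voronoi_cell \<iota> x i" for n
    proof (rule voronoi_cellI)
      show "?w n \<in> unit_cube"
        using convexD_alt[OF conv _ config_D_cube[OF x, of i], of w "t n"] t[of n] w by (simp add: closed_cell_def)
      fix k assume k: "k \<noteq> i"
      have "sqdist_diff x i k (?w n) = (1 - t n) * sqdist_diff x i k w + t n * sqdist_diff x i k (x$i)"
        by (simp add: sqdist_diff_affine inner_add_right algebra_simps)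
      moreover have "0 \<le> (1 - t n) * sqdist_diff x i k w" using t[of n] w by (simp add: closed_cell_iff)
      moreover have "0 < t n * sqdist_diff x i k (x$i)"
        using t[of n] config_D_neq[OF x, of i k] k by (intro mult_pos_pos sqdist_diff_site_pos) auto
      ultimately show "0 < sqdist_diff x i k (?w n)" by simp
    qed
    moreover have "?w \<longlonglongrightarrow> (1 - 0) *\<^sub>R w + 0 *\<^sub>R x$i"
      unfolding t_def by (intro tendsto_intros LIMSEQ_inverse_real_of_nat)
    ultimately show "w \<in> closure (voronoi_cell \<iota> x i)"
      unfolding closure_sequential by (intro exI[of _ ?w]) auto
  qed
qed

lemma voronoi_cell_measurable [measurable]:
  fixes \<iota> :: "'i::finite \<Rightarrow> (int, 'e::{finite,wellorder}) vec"
  shows "voronoi_cell \<iota> x i \<in> sets borel"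
proof -
  have "voronoi_cell \<iota> x i = unit_cube - (\<Union>k\<in>-{i}. {w. norm (x$k - w) < norm (x$i - w)} \<union>
      (if lex_less (\<iota> i) (\<iota> k) then {} else {w. norm (x$i - w) = norm (x$k - w)}))"
    by (auto simp: voronoi_cell_def split: if_splits)
  also have "\<dots> \<in> sets borel"
  proof (intro sets.Diff sets.finite_UN sets.Un)
    show "{w. norm (x$k - w) < norm (x$i - w)} \<in> sets borel" for k
      by (intro borel_open open_Collect_less continuous_intros)
    have "{w. norm (x$i - w) = norm (x$k - w)} \<in> sets borel" for k
      by (intro borel_closed closed_Collect_eq continuous_intros)
    then show "(if lex_less (\<iota> i) (\<iota> k) then {} else {w. norm (x$i - w) = norm (x$k - w)}) \<in> sets borel" for k
      by simp
  qed auto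
  finally show ?thesis .
qed

text \<open>The tie sets are zero sets of \<open>sqdist_diff x i k\<close>, an affine function that
  is positive at the site \<open>x$i\<close>; they are null and the lexicographic rule has no effect
  on the integral.\<close>

lemma voronoi_cell_integral:
  fixes \<iota> :: "'i::finite \<Rightarrow> (int, 'e::{finite,wellorder}) vec" and g :: "real^'d \<Rightarrow> 'b::euclidean_space"
  assumes x: "x \<in> config_D" and g: "continuous_on UNIV g"
  shows "(LINT w:voronoi_cell \<iota> x i|lebesgue. g w) = (\<integral>w. indicator (closed_cell x i) w *\<^sub>R g w \<partial>lborel)"
proof -
  have [measurable]: "g \<in> borel_measurable borel" using g by (rule borel_measurable_continuous_onI)
  have "AE w in lborel. \<forall>k\<in>-{i}. sqdist_diff x i k w \<noteq> 0"
  proof (intro AE_finite_allI)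
    fix k assume "k \<in> -{i}"
    then have "sqdist_diff x i k (x$i) \<noteq> 0"
      using config_D_neq[OF x, of i k] sqdist_diff_site_pos[of x i k] by (metis Compl_iff less_irrefl singletonI)
    then show "AE w in lborel. sqdist_diff x i k w \<noteq> 0"
      by (rule AE_affine_nonzero[OF sqdist_diff_affine])
  qed simp
  then have "AE w in lborel. indicator (voronoi_cell \<iota> x i) w *\<^sub>R g w = indicator (closed_cell x i) w *\<^sub>R g w"
  proof eventually_elim
    case (elim w)
    have "w \<in> voronoi_cell \<iota> x i \<longleftrightarrow> w \<in> closed_cell x i"
    proof
      assume "w \<in> closed_cell x i"
      then show "w \<in> voronoi_cell \<iota> x i"
        using elim by (intro voronoi_cellI) (auto simp: closed_cell_iff order_less_le)
    qed (use voronoi_cell_subset_closed in blast)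
    then show ?case by (simp add: indicator_def)
  qed
  then have "(\<integral>w. indicator (voronoi_cell \<iota> x i) w *\<^sub>R g w \<partial>lborel) = (\<integral>w. indicator (closed_cell x i) w *\<^sub>R g w \<partial>lborel)"
    by (intro integral_cong_AE) auto
  then show ?thesis
    unfolding set_lebesgue_integral_def by (subst integral_completion) auto
qed

section \<open>Facet integrals as functions of the sites\<close>

lemma mediator_integrable:
  fixes x :: "(real^'d)^'i" and \<phi> :: "real^'d \<Rightarrow> 'b::euclidean_space"
  assumes ne: "x$i$a \<noteq> x$k$a" and \<phi>: "continuous_on UNIV \<phi>"
    and A [measurable]: "A \<in> sets borel" and sub: "A \<subseteq> unit_cube"
  shows "set_integrable (mediator_measure x k i) A \<phi>"
proof -
  have [measurable]: "\<phi> \<in> borel_measurable borel" using \<phi> by (rule borel_measurable_continuous_onI)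
  let ?c = "norm (x$i - x$k) / \<bar>x$i$a - x$k$a\<bar>"
  have "integrable lborel (\<lambda>v. ?c *\<^sub>R (indicator (slab (axis a 1)) v *\<^sub>R (indicator A (mediator_proj a x i k v) *\<^sub>R \<phi> (mediator_proj a x i k v))))"
    by (intro integrable_scaleR_right mediator_integrand_integrable \<phi> A sub)
  then show ?thesis
    unfolding set_integrable_def mediator_measure_eq[OF ne]
    by (subst integrable_distr_eq, simp, simp, subst integrable_density) (auto simp: mult_ac)
qed

lemma bounded_config_D: "bounded (config_D :: ((real^'d)^'i) set)"
proof -
  obtain B where B: "B \<ge> 0" "\<And>w. w \<in> unit_cube \<Longrightarrow> norm (w :: real^'d) \<le> B"
    using unit_cube_bound by metis
  have "norm x \<le> (\<Sum>i\<in>(UNIV :: 'i set). B)" if x: "x \<in> config_D" for x :: "(real^'d)^'i"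
  proof -
    have "norm x \<le> (\<Sum>i\<in>UNIV. norm (x$i))"
      unfolding norm_vec_def by (rule L2_set_le_sum) simp
    also have "\<dots> \<le> (\<Sum>i\<in>(UNIV :: 'i set). B)" by (intro sum_mono B config_D_cube x)
    finally show ?thesis .
  qed
  then show ?thesis by (auto simp: bounded_iff)
qed

lemma continuous_on_mediator_proj_sites:
  assumes "i \<noteq> k"
  shows "continuous_on config_D (\<lambda>y. mediator_proj a y i k v)"
  unfolding mediator_proj_def sqdist_diff_def
  by (intro continuous_intros ballI) (simp add: config_D_neq[OF _ assms])

lemma eventually_nonneg_iff:
  fixes u :: "nat \<Rightarrow> real"
  assumes "u \<longlonglongrightarrow> l" "l \<noteq> 0"
  shows "eventually (\<lambda>n. 0 \<le> u n \<longleftrightarrow> 0 \<le> l) sequentially"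
proof (cases "l > 0")
  case True
  from order_tendstoD(1)[OF assms(1) True] show ?thesis by eventually_elim (use True in auto)
next
  case False
  then have "l < 0" using assms(2) by simp
  from order_tendstoD(2)[OF assms(1) this] show ?thesis by eventually_elim (use \<open>l < 0\<close> in auto)
qed

text \<open>In the oblique form the reference measure no longer moves with the sites. Membership in
  the facet is a finite set of sign conditions on quantities continuous in the sites; for almost
  every \<open>v\<close> none of them vanishes at the limit, so the indicator is eventually
  constant.\<close>

lemma facet_integral_continuous:
  fixes \<phi> :: "(real^'d)^'i \<Rightarrow> real^'d \<Rightarrow> 'b::euclidean_space"
  assumes ik: "i \<noteq> k" and \<phi>: "continuous_on UNIV (\<lambda>p. \<phi> (fst p) (snd p))"
  shows "continuous_on config_D (\<lambda>x. LINT w:(closed_cell x i \<inter> closed_cell x k)|mediator_measure x k i. \<phi> x w)"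
proof -
  define a where "a = (undefined :: 'd)"
  let ?e = "axis a 1 :: real^'d"
  let ?Q = "\<lambda>x. mediator_proj a x i k"
  let ?A = "\<lambda>x. closed_cell x i \<inter> closed_cell x k"
  have \<phi>x: "continuous_on UNIV (\<phi> x)" for x
  proof -
    have "continuous_on UNIV (\<lambda>w :: real^'d. (x, w))" by (intro continuous_intros)
    from continuous_on_compose2[OF \<phi> this] show ?thesis by simp
  qed
  have [measurable]: "\<phi> x \<in> borel_measurable borel" for x using \<phi>x by (rule borel_measurable_continuous_onI)
  have ne: "x$i$a \<noteq> x$k$a" if "x \<in> config_D" for x :: "(real^'d)^'i" using config_D_neq[OF that ik] .
  let ?q = "\<lambda>x v. indicator (slab ?e) v *\<^sub>R (indicator (?A x) (?Q x v) *\<^sub>R \<phi> x (?Q x v))"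
  \<comment> \<open>\<open>\<phi>\<close> depends on the sites as well, and \<open>config_D\<close>
    is bounded but need not be closed; compactness of its closure gives one bound for all
    configurations.\<close>
  have "compact ((\<lambda>p. \<phi> (fst p) (snd p)) ` (closure config_D \<times> unit_cube))"
    by (intro compact_continuous_image continuous_on_subset[OF \<phi>] compact_Times compact_unit_cube)
      (auto simp: compact_closure bounded_config_D)
  from compact_imp_bounded[OF this] obtain C where
    C: "norm (\<phi> x w) \<le> C" if "x \<in> closure config_D" "w \<in> unit_cube" for x w
    by (auto simp: bounded_iff)
  have "continuous_on config_D (\<lambda>x. \<integral>v. ?q x v \<partial>lborel)"
    unfolding continuous_on_sequentially comp_def
  proof (intro allI ballI impI)
    fix X :: "nat \<Rightarrow> (real^'d)^'i" and x :: "(real^'d)^'i"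
    assume x: "x \<in> config_D" and "(\<forall>n. X n \<in> config_D) \<and> X \<longlonglongrightarrow> x"
    then have X: "\<And>n. X n \<in> config_D" and Xx: "X \<longlonglongrightarrow> x" by auto
    show "(\<lambda>n. \<integral>v. ?q (X n) v \<partial>lborel) \<longlonglongrightarrow> (\<integral>v. ?q x v \<partial>lborel)"
    proof (rule integral_dominated_convergence)
      show "integrable lborel (\<lambda>v :: real^'d. indicator unit_cube v * \<bar>C\<bar>)" by (simp add: integrable_unit_cube_indicator)
      show "AE v in lborel. norm (?q (X n) v) \<le> indicator unit_cube v * \<bar>C\<bar>" for n
      proof (intro AE_I2)
        fix v
        show "norm (?q (X n) v) \<le> indicator unit_cube v * \<bar>C\<bar>"
        proof (cases "v \<in> slab ?e \<and> ?Q (X n) v \<in> ?A (X n)")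
          case True
          then have Q: "?Q (X n) v \<in> unit_cube" using closed_cell_subset by blast
          then have "v \<in> unit_cube" using True slab_mediator_proj_in_unit_cube by blast
          moreover have "norm (\<phi> (X n) (?Q (X n) v)) \<le> \<bar>C\<bar>"
            using C[OF subsetD[OF closure_subset X] Q] by (meson abs_ge_self order_trans)
          ultimately show ?thesis using True by simp
        qed (auto simp: indicator_def)
      qed
      show "AE v in lborel. (\<lambda>n. ?q (X n) v) \<longlonglongrightarrow> ?q x v"
        using AE_mediator_proj_generic[OF x, of i a]
      proof eventually_elim
        case (elim v)
        have Q: "(\<lambda>n. ?Q (X n) v) \<longlonglongrightarrow> ?Q x v"
          by (rule continuous_on_tendsto_compose[OF continuous_on_mediator_proj_sites[OF ik] Xx x])
            (use X in simp)
        \<comment> \<open>The conditions for \<open>i\<close> and \<open>k\<close> vanish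
          identically on the mediator. They have to be removed before limits of signs can be
          taken.\<close>
        have cell: "?Q y v \<in> ?A y \<longleftrightarrow> (\<forall>b. 0 \<le> ?Q y v $ b \<and> 0 \<le> 1 - ?Q y v $ b) \<and>
            (\<forall>l\<in>-{i}-{k}. 0 \<le> sqdist_diff y i l (?Q y v))" if y: "y \<in> config_D" for y
        proof -
          have z: "sqdist_diff y i k (?Q y v) = 0" "sqdist_diff y i i (?Q y v) = 0"
            using ne[OF y] by (simp_all add: sqdist_diff_mediator_proj_self) (simp add: sqdist_diff_def)
          have "(\<forall>l. 0 \<le> sqdist_diff y i l (?Q y v)) \<longleftrightarrow> (\<forall>l\<in>-{i}-{k}. 0 \<le> sqdist_diff y i l (?Q y v))"
            using z by force
          then show ?thesis
            using closed_cell_sqdist_zero[OF z(1)] by (auto simp: closed_cell_iff unit_cube_def)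
        qed
        have "eventually (\<lambda>n. 0 \<le> ?Q (X n) v $ b \<longleftrightarrow> 0 \<le> ?Q x v $ b) sequentially" for b
          using elim ik by (intro eventually_nonneg_iff tendsto_vec_nth Q) auto
        moreover have "eventually (\<lambda>n. 0 \<le> 1 - ?Q (X n) v $ b \<longleftrightarrow> 0 \<le> 1 - ?Q x v $ b) sequentially" for b
          using elim ik by (intro eventually_nonneg_iff tendsto_intros tendsto_vec_nth Q) auto
        moreover have "eventually (\<lambda>n. \<forall>l\<in>-{i}-{k}. 0 \<le> sqdist_diff (X n) i l (?Q (X n) v) \<longleftrightarrow> 0 \<le> sqdist_diff x i l (?Q x v)) sequentially"
        proof (intro eventually_ball_finite ballI)
          fix l assume l: "l \<in> -{i}-{k}"
          have "(\<lambda>n. sqdist_diff (X n) i l (?Q (X n) v)) \<longlonglongrightarrow> sqdist_diff x i l (?Q x v)"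
            unfolding sqdist_diff_def by (intro tendsto_intros tendsto_vec_nth Q Xx)
          then show "eventually (\<lambda>n. 0 \<le> sqdist_diff (X n) i l (?Q (X n) v) \<longleftrightarrow> 0 \<le> sqdist_diff x i l (?Q x v)) sequentially"
            by (rule eventually_nonneg_iff) (use elim l ik in auto)
        qed simp
        ultimately have "eventually (\<lambda>n. (\<forall>b. 0 \<le> ?Q (X n) v $ b \<longleftrightarrow> 0 \<le> ?Q x v $ b) \<and>
            (\<forall>b. 0 \<le> 1 - ?Q (X n) v $ b \<longleftrightarrow> 0 \<le> 1 - ?Q x v $ b) \<and>
            (\<forall>l\<in>-{i}-{k}. 0 \<le> sqdist_diff (X n) i l (?Q (X n) v) \<longleftrightarrow> 0 \<le> sqdist_diff x i l (?Q x v))) sequentially"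
          by (intro eventually_conj eventually_all_finite) auto
        then have "eventually (\<lambda>n. indicator (?A (X n)) (?Q (X n) v) = (indicator (?A x) (?Q x v) :: real)) sequentially"
        proof eventually_elim
          case (elim n)
          then have "?Q (X n) v \<in> ?A (X n) \<longleftrightarrow> ?Q x v \<in> ?A x"
            unfolding cell[OF X] cell[OF x] by simp
          then show ?case by (simp only: indicator_def)
        qed
        then have "(\<lambda>n. indicator (?A (X n)) (?Q (X n) v) :: real) \<longlonglongrightarrow> indicator (?A x) (?Q x v)"
          by (rule tendsto_eventually)
        moreover have "(\<lambda>n. \<phi> (X n) (?Q (X n) v)) \<longlonglongrightarrow> \<phi> x (?Q x v)"
          using continuous_on_tendsto_compose[OF \<phi> tendsto_Pair[OF Xx Q]] by simp
        ultimately show ?case by (intro tendsto_intros)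
      qed
    qed measurable
  qed
  then have "continuous_on config_D (\<lambda>x. (norm (x$i - x$k) / \<bar>x$i$a - x$k$a\<bar>) *\<^sub>R (\<integral>v. ?q x v \<partial>lborel))"
    by (intro continuous_intros) (use ne in auto)
  then show ?thesis
    by (rule continuous_on_cong[THEN iffD1, rotated -1])
      (use ne in \<open>auto simp: set_lebesgue_integral_def mediator_integral[where a=a]\<close>)
qed

section \<open>The gradient of the distortion\<close>

lemma quant_V_cong:
  assumes "\<And>w. w \<in> unit_cube \<Longrightarrow> f w = f' w"
  shows "quant_V \<iota> \<Lambda> f = quant_V \<iota> \<Lambda> f'"
proof
  fix x
  have "(LINT w:voronoi_cell \<iota> x i|lebesgue. (norm (x$j - w))\<^sup>2 * f w)
      = (LINT w:voronoi_cell \<iota> x i|lebesgue. (norm (x$j - w))\<^sup>2 * f' w)" for i j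
    unfolding set_lebesgue_integral_def using assms voronoi_cell_subset[of \<iota> x i]
    by (intro Bochner_Integration.integral_cong) (auto simp: indicator_def)
  then show "quant_V \<iota> \<Lambda> f x = quant_V \<iota> \<Lambda> f' x" by (simp only: quant_V_def)
qed

lemma grad_V_cong:
  fixes f f' :: "real^'d \<Rightarrow> real"
  assumes f: "\<And>w. w \<in> unit_cube \<Longrightarrow> f w = f' w"
  shows "grad_V \<iota> \<Lambda> f x i = grad_V \<iota> \<Lambda> f' x i"
proof -
  have cl: "closure (voronoi_cell \<iota> x k) \<subseteq> unit_cube" for k
    by (intro closure_minimal voronoi_cell_subset compact_imp_closed compact_unit_cube)
  have "(LINT w:voronoi_cell \<iota> x k|lebesgue. f w *\<^sub>R (x$i - w))
      = (LINT w:voronoi_cell \<iota> x k|lebesgue. f' w *\<^sub>R (x$i - w))" for k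
    unfolding set_lebesgue_integral_def using f voronoi_cell_subset[of \<iota> x k]
    by (intro Bochner_Integration.integral_cong) (auto simp: indicator_def)
  moreover have "(LINT w:closure (voronoi_cell \<iota> x k) \<inter> closure (voronoi_cell \<iota> x i)|M. f w *\<^sub>R u w)
      = (LINT w:closure (voronoi_cell \<iota> x k) \<inter> closure (voronoi_cell \<iota> x i)|M. f' w *\<^sub>R u w)"
    for k and M :: "(real^'d) measure" and u :: "real^'d \<Rightarrow> real^'d"
    unfolding set_lebesgue_integral_def using f cl[of k]
    by (intro Bochner_Integration.integral_cong) (auto simp: indicator_def)
  ultimately show ?thesis by (simp only: grad_V_def)
qed

section \<open>Cells and integrand moving together\<close>

definition cell_integral :: "(real^'d \<Rightarrow> 'b::euclidean_space) \<Rightarrow> 'i \<Rightarrow> (real^'d)^'i \<Rightarrow> 'b" where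
  "cell_integral g i x = (\<integral>w. indicator (closed_cell x i) w *\<^sub>R g w \<partial>lborel)"

text \<open>The vector \<open>(1/2) *\<^sub>R nvec x k i\<close> plus the scaled difference between
  midpoint and \<open>w\<close> collapses to \<open>x$i - w\<close> divided by the distance of the
  sites. This is the boundary term of \<open>grad_V\<close> after that simplification,
  \<open>j\<close> being the site whose squared distance is integrated.\<close>

definition facet_force :: "(real^'d \<Rightarrow> real) \<Rightarrow> 'i \<Rightarrow> 'i \<Rightarrow> 'i \<Rightarrow> (real^'d)^'i \<Rightarrow> real^'d" where
  "facet_force f i k j x = (1 / norm (x$i - x$k)) *\<^sub>R
     (LINT w:closed_cell x i \<inter> closed_cell x k|mediator_measure x k i. (f w * (norm (x$j - w))\<^sup>2) *\<^sub>R (x$i - w))"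

lemma
  fixes u :: "'v \<Rightarrow> 'b::euclidean_space"
  assumes "set_integrable M A u"
  shows set_integral_inner_left: "(LINT w:A|M. u w \<bullet> c) = (LINT w:A|M. u w) \<bullet> c"
    and set_integrable_inner_left: "set_integrable M A (\<lambda>w. u w \<bullet> c)"
  using integral_inner_left[of c M "\<lambda>w. indicator A w *\<^sub>R u w"]
    integrable_inner_left[of c M "\<lambda>w. indicator A w *\<^sub>R u w"] assms
  by (simp_all add: set_lebesgue_integral_def set_integrable_def)

text \<open>The normal speed splits into a part linear in \<open>h$k\<close> and one linear in
  \<open>h$i\<close>. The former is the force on \<open>k\<close>, once the facet measure is read
  from the other side.\<close>

lemma cell_integral_weighted_deriv:
  fixes x :: "(real^'d)^'i::finite"
  assumes x: "x \<in> config_D" and f: "continuous_on UNIV f"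
  shows "(cell_integral (\<lambda>w. (norm (x$j - w))\<^sup>2 * f w) i has_derivative
     (\<lambda>h. \<Sum>k\<in>-{i}. facet_force f k i j x \<bullet> h$k - facet_force f i k j x \<bullet> h$i)) (at x within config_D)"
proof -
  define a where "a = (undefined :: 'd)"
  have "(LINT w:(closed_cell x i \<inter> closed_cell x k)|mediator_measure x k i.
       (((x$k - w) \<bullet> h$k - (x$i - w) \<bullet> h$i) / norm (x$i - x$k)) *\<^sub>R ((norm (x$j - w))\<^sup>2 * f w))
     = facet_force f k i j x \<bullet> h$k - facet_force f i k j x \<bullet> h$i" if "k \<in> -{i}" for k h
  proof -
    let ?M = "mediator_measure x k i" and ?A = "closed_cell x i \<inter> closed_cell x k"
    have ik: "i \<noteq> k" using that by auto
    have ne: "x$i$a \<noteq> x$k$a" using config_D_neq[OF x ik] .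
    let ?u = "\<lambda>l w. (f w * (norm (x$j - w))\<^sup>2) *\<^sub>R (x$l - w)"
    have int: "set_integrable ?M ?A (?u l)" for l
      by (rule mediator_integrable[OF ne]) (use closed_cell_subset in \<open>auto intro!: continuous_intros f\<close>)
    note inner = set_integral_inner_left[OF int] set_integrable_inner_left[OF int]
    have "(LINT w:?A|?M. (((x$k - w) \<bullet> h$k - (x$i - w) \<bullet> h$i) / norm (x$i - x$k)) *\<^sub>R ((norm (x$j - w))\<^sup>2 * f w))
      = (LINT w:?A|?M. (1 / norm (x$i - x$k)) * (?u k w \<bullet> h$k - ?u i w \<bullet> h$i))"
      by (simp add: algebra_simps add_divide_distrib diff_divide_distrib)
    also have "\<dots> = (1 / norm (x$i - x$k)) * ((LINT w:?A|?M. ?u k w) \<bullet> h$k - (LINT w:?A|?M. ?u i w) \<bullet> h$i)"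
      using inner by (simp add: set_integral_diff)
    also have "\<dots> = facet_force f k i j x \<bullet> h$k - facet_force f i k j x \<bullet> h$i"
      by (simp add: facet_force_def mediator_measure_commute[OF ne] norm_minus_commute Int_commute right_diff_distrib)
    finally show ?thesis .
  qed
  moreover have "continuous_on UNIV (\<lambda>w. (norm (x$j - w))\<^sup>2 * f w)" by (intro continuous_intros f)
  ultimately show ?thesis
    using cell_integral_deriv[OF x, of "\<lambda>w. (norm (x$j - w))\<^sup>2 * f w" i] by (simp add: cell_integral_def[abs_def])
qed

lemma cell_integral_integrable:
  fixes g :: "real^'d \<Rightarrow> 'b::euclidean_space"
  assumes "continuous_on UNIV g"
  shows "integrable lborel (\<lambda>w. indicator (closed_cell x i) w *\<^sub>R g w)"
  by (rule integrable_continuous_bounded[OF assms _ closed_cell_subset compact_unit_cube]) simp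

text \<open>After the expansion every integrand is fixed. As \<open>y$j - x$j\<close> vanishes at
  \<open>y = x\<close>, the derivatives of the two correction integrals drop out, and of their
  values only the first moment survives.\<close>

lemma cell_integral_moving_deriv:
  fixes x :: "(real^'d)^'i::finite" and f :: "real^'d \<Rightarrow> real"
  assumes x: "x \<in> config_D" and f: "continuous_on UNIV f"
  shows "((\<lambda>y. cell_integral (\<lambda>w. (norm (y$j - w))\<^sup>2 * f w) i y) has_derivative
     (\<lambda>h. (\<Sum>k\<in>-{i}. facet_force f k i j x \<bullet> h$k - facet_force f i k j x \<bullet> h$i) +
        2 * (cell_integral (\<lambda>w. f w *\<^sub>R (x$j - w)) i x \<bullet> h$j))) (at x within config_D)"
proof -
  let ?m = "\<lambda>w. f w *\<^sub>R (x$j - w)"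
  have m: "continuous_on UNIV ?m" and s: "continuous_on UNIV (\<lambda>w. (norm (x$j - w))\<^sup>2 * f w)"
    by (intro continuous_intros f)+
  have eq: "cell_integral (\<lambda>w. (norm (y$j - w))\<^sup>2 * f w) i y = cell_integral (\<lambda>w. (norm (x$j - w))\<^sup>2 * f w) i y
      + 2 * (cell_integral ?m i y \<bullet> (y$j - x$j)) + ((y$j - x$j) \<bullet> (y$j - x$j)) * cell_integral f i y" for y
  proof -
    have lin: "integrable M m \<Longrightarrow> integrable M u \<Longrightarrow> integrable M r \<Longrightarrow>
        (\<integral>w. u w + 2 * (m w \<bullet> c) + d * r w \<partial>M) = (\<integral>w. u w \<partial>M) + 2 * ((\<integral>w. m w \<partial>M) \<bullet> c) + d * (\<integral>w. r w \<partial>M)"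
      for M :: "(real^'d) measure" and m :: "real^'d \<Rightarrow> real^'d" and u r c d
      by simp
    have "cell_integral (\<lambda>w. (norm (y$j - w))\<^sup>2 * f w) i y =
      (\<integral>w. indicator (closed_cell y i) w *\<^sub>R ((norm (x$j - w))\<^sup>2 * f w)
        + 2 * ((indicator (closed_cell y i) w *\<^sub>R ?m w) \<bullet> (y$j - x$j))
        + ((y$j - x$j) \<bullet> (y$j - x$j)) * (indicator (closed_cell y i) w *\<^sub>R f w) \<partial>lborel)"
      unfolding cell_integral_def
    proof (intro Bochner_Integration.integral_cong refl)
      fix w
      have "(norm (y$j - w))\<^sup>2 = (norm (x$j - w))\<^sup>2 + 2 * ((x$j - w) \<bullet> (y$j - x$j)) + (y$j - x$j) \<bullet> (y$j - x$j)"
        by (simp add: power2_norm_eq_inner inner_diff_left inner_diff_right inner_commute)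
      then show "indicator (closed_cell y i) w *\<^sub>R ((norm (y$j - w))\<^sup>2 * f w) = indicator (closed_cell y i) w *\<^sub>R ((norm (x$j - w))\<^sup>2 * f w)
        + 2 * ((indicator (closed_cell y i) w *\<^sub>R ?m w) \<bullet> (y$j - x$j))
        + ((y$j - x$j) \<bullet> (y$j - x$j)) * (indicator (closed_cell y i) w *\<^sub>R f w)"
        by (simp only: real_scaleR_def inner_scaleR_left) (simp only: algebra_simps)
    qed
    also have "\<dots> = cell_integral (\<lambda>w. (norm (x$j - w))\<^sup>2 * f w) i y
      + 2 * (cell_integral ?m i y \<bullet> (y$j - x$j)) + ((y$j - x$j) \<bullet> (y$j - x$j)) * cell_integral f i y"
      unfolding cell_integral_def
      using cell_integral_integrable[OF m, of y i] cell_integral_integrable[OF s, of y i] cell_integral_integrable[OF f, of y i]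
      by (rule lin)
    finally show ?thesis .
  qed
  have dj: "((\<lambda>y. y$j - x$j) has_derivative (\<lambda>h. h$j)) (at x within config_D)"
    by (rule derivative_eq_intros bounded_linear.has_derivative[OF bounded_linear_vec_nth has_derivative_ident] refl)+ simp
  have dm: "((\<lambda>y. cell_integral ?m i y) has_derivative (\<lambda>h. \<Sum>k\<in>-{i}. LINT w:(closed_cell x i \<inter> closed_cell x k)|mediator_measure x k i.
       (((x$k - w) \<bullet> h$k - (x$i - w) \<bullet> h$i) / norm (x$i - x$k)) *\<^sub>R ?m w)) (at x within config_D)"
    unfolding cell_integral_def by (rule cell_integral_deriv[OF x m])
  have df: "((\<lambda>y. cell_integral f i y) has_derivative (\<lambda>h. \<Sum>k\<in>-{i}. LINT w:(closed_cell x i \<inter> closed_cell x k)|mediator_measure x k i.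
       (((x$k - w) \<bullet> h$k - (x$i - w) \<bullet> h$i) / norm (x$i - x$k)) *\<^sub>R f w)) (at x within config_D)"
    unfolding cell_integral_def by (rule cell_integral_deriv[OF x f])
  show ?thesis
    unfolding eq
    by (rule derivative_eq_intros cell_integral_weighted_deriv[OF x f] dj dm df refl)+ simp
qed

lemma quant_V_eq:
  assumes x: "x \<in> config_D" and f: "continuous_on UNIV f"
  shows "quant_V \<iota> \<Lambda> f x = (1/2) * (\<Sum>i\<in>UNIV. \<Sum>j\<in>UNIV. \<Lambda> (\<iota> i - \<iota> j) *
      cell_integral (\<lambda>w. (norm (x$j - w))\<^sup>2 * f w) i x)"
proof -
  have "continuous_on UNIV (\<lambda>w. (norm (x$j - w))\<^sup>2 * f w)" for j by (intro continuous_intros f)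
  then show ?thesis by (simp add: quant_V_def voronoi_cell_integral[OF x] cell_integral_def)
qed

lemma grad_V_eq:
  fixes \<iota> :: "'i::finite \<Rightarrow> (int, 'e::{finite,wellorder}) vec" and f :: "real^'d \<Rightarrow> real"
  assumes x: "x \<in> config_D" and f: "continuous_on UNIV f"
  shows "grad_V \<iota> \<Lambda> f x i = (\<Sum>k\<in>UNIV. \<Lambda> (\<iota> i - \<iota> k) *\<^sub>R cell_integral (\<lambda>w. f w *\<^sub>R (x$i - w)) k x)
     + (1/2) *\<^sub>R (\<Sum>j\<in>UNIV. \<Sum>k\<in>-{i}. (\<Lambda> (\<iota> k - \<iota> j) - \<Lambda> (\<iota> i - \<iota> j)) *\<^sub>R facet_force f i k j x)"
proof -
  have "continuous_on UNIV (\<lambda>w. f w *\<^sub>R (x$i - w))" by (intro continuous_intros f)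
  note cell = voronoi_cell_integral[OF x this, folded cell_integral_def]
  have "(LINT w:closed_cell x k \<inter> closed_cell x i|mediator_measure x k i.
            f w *\<^sub>R ((norm (x$j - w))\<^sup>2 *\<^sub>R
              ((1/2) *\<^sub>R nvec x k i + (1 / norm (x$k - x$i)) *\<^sub>R ((1/2) *\<^sub>R (x$i + x$k) - w)))) = facet_force f i k j x" for j k
  proof -
    have half: "(1/2) *\<^sub>R z + (1/2) *\<^sub>R z = z" for z :: "real^'d" by (simp flip: scaleR_add_left)
    have "(1/2) *\<^sub>R nvec x k i + (1 / norm (x$k - x$i)) *\<^sub>R ((1/2) *\<^sub>R (x$i + x$k) - w)
       = (1 / norm (x$i - x$k)) *\<^sub>R ((1/2) *\<^sub>R (x$i - x$k) + ((1/2) *\<^sub>R (x$i + x$k) - w))" for w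
      by (simp add: nvec_def norm_minus_commute[of "x$k"] scaleR_add_right)
    moreover have "(1/2) *\<^sub>R (x$i - x$k) + ((1/2) *\<^sub>R (x$i + x$k) - w) = x$i - w" for w
      using half[of "x$i"] by (simp add: scaleR_add_right scaleR_diff_right)
    ultimately have "f w *\<^sub>R ((norm (x$j - w))\<^sup>2 *\<^sub>R
              ((1/2) *\<^sub>R nvec x k i + (1 / norm (x$k - x$i)) *\<^sub>R ((1/2) *\<^sub>R (x$i + x$k) - w)))
        = (1 / norm (x$i - x$k)) *\<^sub>R ((f w * (norm (x$j - w))\<^sup>2) *\<^sub>R (x$i - w))" for w
      by simp
    then show ?thesis
      by (simp only: facet_force_def set_integral_scaleR_right Int_commute)
  qed
  moreover have "{k. k \<noteq> i} = -{i}" by auto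
  ultimately show ?thesis by (simp add: grad_V_def closure_voronoi_cell[OF x] cell)
qed

text \<open>Collecting by the site that moves: the force on a neighbour \<open>k\<close> of the cell
  \<open>i\<close> becomes, after exchanging the two names, a force on \<open>i\<close> with
  coefficient taken at \<open>k\<close>. The difference of coefficients thus records mass passing
  from one cell to the other. In the cell terms the symmetry of \<open>\<Lambda>\<close> permits the
  exchange, and the 2 from the square cancels the 1/2.\<close>

lemma grad_V_sum:
  fixes \<iota> :: "'i::finite \<Rightarrow> (int, 'e::{finite,wellorder}) vec" and x h :: "(real^'d)^'i"
  assumes x: "x \<in> config_D" and f: "continuous_on UNIV f"
    and sym: "\<forall>i j. \<Lambda> (\<iota> j - \<iota> i) = \<Lambda> (\<iota> i - \<iota> j)"
  shows "(1/2) * (\<Sum>i\<in>UNIV. \<Sum>j\<in>UNIV. \<Lambda> (\<iota> i - \<iota> j) *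
      ((\<Sum>k\<in>-{i}. facet_force f k i j x \<bullet> h$k - facet_force f i k j x \<bullet> h$i) +
        2 * (cell_integral (\<lambda>w. f w *\<^sub>R (x$j - w)) i x \<bullet> h$j)))
    = (\<Sum>i\<in>UNIV. grad_V \<iota> \<Lambda> f x i \<bullet> h$i)"
proof -
  let ?L = "\<lambda>i j. \<Lambda> (\<iota> i - \<iota> j)"
  let ?R = "\<lambda>i k j. facet_force f i k j x \<bullet> h$i"
  let ?c = "\<lambda>i j. cell_integral (\<lambda>w. f w *\<^sub>R (x$j - w)) i x \<bullet> h$j"
  \<comment> \<open>The diagonal term is zero both before and after collecting, so the sums may run
    over all indices, where the exchange of names is free.\<close>
  have full: "(\<Sum>k\<in>-{i}. u k) = (\<Sum>k\<in>UNIV. u k)" if "u i = 0" for u :: "'i \<Rightarrow> real" and i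
    by (rule sum.mono_neutral_left) (use that in auto)
  have "(\<Sum>i\<in>UNIV. \<Sum>j\<in>UNIV. ?L i j * (\<Sum>k\<in>UNIV. ?R k i j - ?R i k j))
     = (\<Sum>i\<in>UNIV. \<Sum>j\<in>UNIV. \<Sum>k\<in>UNIV. ?L i j * ?R k i j) - (\<Sum>i\<in>UNIV. \<Sum>j\<in>UNIV. \<Sum>k\<in>UNIV. ?L i j * ?R i k j)"
    by (simp add: sum_distrib_left right_diff_distrib sum_subtractf)
  also have "(\<Sum>i\<in>UNIV. \<Sum>j\<in>UNIV. \<Sum>k\<in>UNIV. ?L i j * ?R k i j) = (\<Sum>k\<in>UNIV. \<Sum>j\<in>UNIV. \<Sum>i\<in>UNIV. ?L i j * ?R k i j)"
    by (subst (2) sum.swap, subst sum.swap, subst (2) sum.swap, rule refl)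
  finally have facets: "(\<Sum>i\<in>UNIV. \<Sum>j\<in>UNIV. ?L i j * (\<Sum>k\<in>UNIV. ?R k i j - ?R i k j))
      = (\<Sum>i\<in>UNIV. \<Sum>j\<in>UNIV. \<Sum>k\<in>UNIV. (?L k j - ?L i j) * ?R i k j)"
    by (simp add: left_diff_distrib sum_subtractf)
  have cells: "(\<Sum>i\<in>UNIV. \<Sum>j\<in>UNIV. ?L i j * ?c i j) = (\<Sum>i\<in>UNIV. \<Sum>k\<in>UNIV. ?L i k * ?c k i)"
    using sym by (subst sum.swap) simp
  have "(1/2) * (\<Sum>i\<in>UNIV. \<Sum>j\<in>UNIV. ?L i j * ((\<Sum>k\<in>-{i}. ?R k i j - ?R i k j) + 2 * ?c i j))
    = (1/2) * ((\<Sum>i\<in>UNIV. \<Sum>j\<in>UNIV. ?L i j * (\<Sum>k\<in>UNIV. ?R k i j - ?R i k j)) + 2 * (\<Sum>i\<in>UNIV. \<Sum>j\<in>UNIV. ?L i j * ?c i j))"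
    by (simp add: full distrib_left sum.distrib sum_distrib_left mult.left_commute)
  also have "\<dots> = (\<Sum>i\<in>UNIV. (\<Sum>k\<in>UNIV. ?L i k * ?c k i) + (1/2) * (\<Sum>j\<in>UNIV. \<Sum>k\<in>UNIV. (?L k j - ?L i j) * ?R i k j))"
    unfolding facets cells by (simp add: distrib_left sum.distrib sum_distrib_left)
  also have "\<dots> = (\<Sum>i\<in>UNIV. (\<Sum>k\<in>UNIV. ?L i k * ?c k i) + (1/2) * (\<Sum>j\<in>UNIV. \<Sum>k\<in>-{i}. (?L k j - ?L i j) * ?R i k j))"
    by (simp add: full)
  also have "\<dots> = (\<Sum>i\<in>UNIV. grad_V \<iota> \<Lambda> f x i \<bullet> h$i)"
    by (simp add: grad_V_eq[OF x f] inner_add_left inner_sum_left)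
  finally show ?thesis .
qed

text \<open>The integrand \<open>f w *\<^sub>R (x$i - w)\<close> depends on \<open>x\<close>;
  splitting it leaves cell integrals of fixed functions, which are continuous because they are
  differentiable. The facet part is \<open>facet_integral_continuous\<close>.\<close>

lemma grad_V_continuous:
  fixes \<iota> :: "'i::finite \<Rightarrow> (int, 'e::{finite,wellorder}) vec"
  assumes f: "continuous_on UNIV (f :: real^'d \<Rightarrow> real)"
  shows "continuous_on config_D (\<lambda>x. grad_V \<iota> \<Lambda> f x i)"
proof -
  have cell: "continuous_on config_D (cell_integral g k)" if "continuous_on UNIV g"
    for g :: "real^'d \<Rightarrow> 'b::euclidean_space" and k :: 'i
    unfolding cell_integral_def
    by (rule has_derivative_continuous_on) (rule cell_integral_deriv[OF _ that])
  have "cell_integral (\<lambda>w. f w *\<^sub>R (x$i - w)) k x = cell_integral f k x *\<^sub>R x$i - cell_integral (\<lambda>w. f w *\<^sub>R w) k x"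
    for x :: "(real^'d)^'i" and k
  proof -
    have "continuous_on UNIV (\<lambda>w. f w *\<^sub>R w)" by (intro continuous_intros f)
    from cell_integral_integrable[OF this, of x k] cell_integral_integrable[OF f, of x k]
    have "(\<integral>w. (indicator (closed_cell x k) w *\<^sub>R f w) *\<^sub>R x$i - indicator (closed_cell x k) w *\<^sub>R f w *\<^sub>R w \<partial>lborel)
      = cell_integral f k x *\<^sub>R x$i - cell_integral (\<lambda>w. f w *\<^sub>R w) k x"
      unfolding cell_integral_def
      by (subst Bochner_Integration.integral_diff) (auto intro: integrable_scaleR_left simp del: scaleR_scaleR real_scaleR_def)
    then show ?thesis by (simp add: cell_integral_def scaleR_diff_right)
  qed
  moreover have "continuous_on config_D (\<lambda>x. cell_integral f k x *\<^sub>R x$i - cell_integral (\<lambda>w. f w *\<^sub>R w) k x)" for k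
    by (intro continuous_intros cell f)
  ultimately have "continuous_on config_D (\<lambda>x. cell_integral (\<lambda>w. f w *\<^sub>R (x$i - w)) k x)" for k
    by simp
  moreover have "continuous_on config_D (facet_force f i k j)" if k: "k \<in> -{i}" for k j
  proof -
    have ik: "i \<noteq> k" using k by auto
    have f2: "continuous_on UNIV (\<lambda>p :: ((real^'d)^'i) \<times> (real^'d). f (snd p))"
      by (rule continuous_on_compose2[OF f]) (auto intro: continuous_intros)
    have "x$i - x$k \<noteq> 0" if "x \<in> config_D" for x :: "(real^'d)^'i"
      using config_D_neq[OF that ik] by auto
    then show ?thesis
      unfolding facet_force_def
      by (intro continuous_intros facet_integral_continuous[OF ik] f2) auto
  qed
  ultimately have "continuous_on config_D (\<lambda>x. (\<Sum>k\<in>UNIV. \<Lambda> (\<iota> i - \<iota> k) *\<^sub>R cell_integral (\<lambda>w. f w *\<^sub>R (x$i - w)) k x)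
     + (1/2) *\<^sub>R (\<Sum>j\<in>UNIV. \<Sum>k\<in>-{i}. (\<Lambda> (\<iota> k - \<iota> j) - \<Lambda> (\<iota> i - \<iota> j)) *\<^sub>R facet_force f i k j x))"
    by (intro continuous_intros)
  then show ?thesis by (simp only: grad_V_eq[OF _ f] cong: continuous_on_cong)
qed

theorem theorem1:
  fixes \<iota> :: "'i::finite \<Rightarrow> (int, 'e::{finite,wellorder}) vec"
    and \<Lambda> :: "(int, 'e) vec \<Rightarrow> real"
    and f :: "real^'d \<Rightarrow> real"
  assumes "CARD('e) \<le> CARD('d)"
    and "inj \<iota>"
    and "\<forall>i j. 0 \<le> \<Lambda> (\<iota> i - \<iota> j) \<and> \<Lambda> (\<iota> i - \<iota> j) \<le> 1"
    and "\<forall>i j. \<Lambda> (\<iota> j - \<iota> i) = \<Lambda> (\<iota> i - \<iota> j)"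
    and "\<Lambda> 0 = 1"
    and "continuous_on unit_cube f"
  shows "(\<forall>x\<in>config_D.
            (quant_V \<iota> \<Lambda> f has_derivative (\<lambda>h. \<Sum>i\<in>UNIV. grad_V \<iota> \<Lambda> f x i \<bullet> h$i)) (at x within config_D))
         \<and> continuous_on config_D (\<lambda>x. \<chi> i. grad_V \<iota> \<Lambda> f x i)"
proof -
  \<comment> \<open>The sections of the density along whole lines must be continuous, but
    \<open>f\<close> is so only on the cube. A Tietze extension changes neither the distortion nor
    its gradient.\<close>
  have "closedin (top_of_set UNIV) (unit_cube :: (real^'d) set)"
    by (simp add: compact_imp_closed compact_unit_cube)
  from Tietze_unbounded[OF assms(6) this] obtain g where
    g: "continuous_on UNIV g" and gf: "\<And>w. w \<in> unit_cube \<Longrightarrow> g w = f w" by metis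
  have V: "quant_V \<iota> \<Lambda> f = quant_V \<iota> \<Lambda> g" by (rule quant_V_cong) (simp add: gf)
  have G: "grad_V \<iota> \<Lambda> f = grad_V \<iota> \<Lambda> g" by (intro ext grad_V_cong) (simp add: gf)
  have "(quant_V \<iota> \<Lambda> g has_derivative (\<lambda>h. \<Sum>i\<in>UNIV. grad_V \<iota> \<Lambda> g x i \<bullet> h$i)) (at x within config_D)"
    if x: "x \<in> config_D" for x
  proof -
    have "((\<lambda>y. (1/2) * (\<Sum>i\<in>UNIV. \<Sum>j\<in>UNIV. \<Lambda> (\<iota> i - \<iota> j) *
        cell_integral (\<lambda>w. (norm (y$j - w))\<^sup>2 * g w) i y)) has_derivative
      (\<lambda>h. (1/2) * (\<Sum>i\<in>UNIV. \<Sum>j\<in>UNIV. \<Lambda> (\<iota> i - \<iota> j) *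
      ((\<Sum>k\<in>-{i}. facet_force g k i j x \<bullet> h$k - facet_force g i k j x \<bullet> h$i) +
        2 * (cell_integral (\<lambda>w. g w *\<^sub>R (x$j - w)) i x \<bullet> h$j))))) (at x within config_D)"
      by (intro has_derivative_mult_right has_derivative_sum cell_integral_moving_deriv x g)
    \<comment> \<open>The closed-cell form of the distortion is available on
      \<open>config_D\<close>, which is enough for a derivative within that set.\<close>
    then show ?thesis
      unfolding grad_V_sum[OF x g assms(4)]
      by (rule has_derivative_transform[OF x, rotated]) (rule quant_V_eq[OF _ g])
  qed
  moreover have "continuous_on config_D (\<lambda>x. \<chi> i. grad_V \<iota> \<Lambda> g x i)"
    by (intro continuous_on_vec_lambda grad_V_continuous g)
  ultimately show ?thesis unfolding V G by blast
qed

end
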